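(* Let $q,\omega,c$ and the sets $X_{i,c}$ be as in the context. Write $X_{1,c}=\{\alpha,\beta\}$ and $X_{1,c+q+1}=\{\alpha,\gamma\}$, where $\alpha$ is the unique element of $X_{1,c}\cap X_{1,c+q+1}$. Let $A=\{\beta\}\cup X_{3,c}$, $B=\{\alpha\}\cup X_{3,c}$, $A'=X_{1,c+q+1}\cup X_{3,c+q+1}$, $B'=X_{3,c+q+1}$. Let $\tau=0$ if $q\equiv3\pmod4$ and $\tau=1$ if $q\equiv1\pmod4$. Then the sets $$C_0=\{(0,y)\mid y\in C_\tau^{(2,q^2)}\}\cup\{(xy,xy^{-1}\omega^i)\mid x\in\mathbb{F}_q^*,y\in C_0^{(2,q^2)},i\in A\}\cup\{(xy,xy^{-1}\omega^i)\mid x\in\mathbb{F}_q^*,y\in C_1^{(2,q^2)},i\in B\},$$ $$C_1=\{(y,0)\mid y\in C_0^{(2,q^2)}\}\cup\{(xy,xy^{-1}\omega^i)\mid x\in\mathbb{F}_q^*,y\in C_0^{(2,q^2)},i\in A'\}\cup\{(xy,xy^{-1}\omega^i)\mid x\in\mathbb{F}_q^*,y\in C_1^{(2,q^2)},i\in B'\},$$ $$C_2=\{(0,y)\mid y\in C_{\tau+1}^{(2,q^2)}\}\cup\{(xy\omega,xy^{-1}\omega^{i+q})\mid x\in\mathbb{F}_q^*,y\in C_0^{(2,q^2)},i\in A\}\cup\{(xy\omega,xy^{-1}\omega^{i+q})\mid x\in\mathbb{F}_q^*,y\in C_1^{(2,q^2)},i\in B\},$$ $$C_3=\{(y,0)\mid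 y\in C_1^{(2,q^2)}\}\cup\{(xy\omega,xy^{-1}\omega^{i+q})\mid x\in\mathbb{F}_q^*,y\in C_0^{(2,q^2)},i\in A'\}\cup\{(xy\omega,xy^{-1}\omega^{i+q})\mid x\in\mathbb{F}_q^*,y\in C_1^{(2,q^2)},i\in B'\}$$ are of type Q. Furthermore, $C_0,C_1,C_2,C_3$ are pairwise disjoint subsets of $(\mathbb{F}_{q^2}\times\mathbb{F}_{q^2})\setminus\{(0,0)\}$, and the spread consisting of the $2$-dimensional $\mathbb{F}_q$-subspaces $$\{(x,yx^q)\mid x\in\mathbb{F}_{q^2}\}\ (y\in\mathbb{F}_{q^2}),\qquad \{(0,x)\mid x\in\mathbb{F}_{q^2}\}$$ can be enumerated as $K_0,K_1,\ldots,K_{q^2}$ so that $C_0\cup C_2\cup\{(0,0)\}=\bigcup_{i=0}^{(q^2-1)/2}K_i$ and $C_1\cup C_3\cup\{(0,0)\}=\bigcup_{i=(q^2+1)/2}^{q^2}K_i$.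
   Context: Let $q$ be an odd prime power, a power of the prime $p$, let $\omega$ be a primitive element of $\mathbb{F}_{q^2}$, and let $c$ be an odd integer in $\{0,1,\ldots,2q+1\}=\mathbb{Z}_{2q+2}$. $\mathrm{Tr}_{q^2/q}(x)=x+x^q$. $C_0^{(2,q)}$ and $C_1^{(2,q)}$ are the sets of nonzero squares and of nonsquares of $\mathbb{F}_q$; $C_i^{(N,q^2)}=\omega^i\langle\omega^N\rangle$ for $N\mid q^2-1$ (index modulo $N$). In $\mathbb{Z}_{2q+2}$ put $I_1=\{i\mid \mathrm{Tr}_{q^2/q}(\omega^i)=0\}$, $I_2=\{i\mid \mathrm{Tr}_{q^2/q}(\omega^i)\in C_0^{(2,q)}\}$, $I_3=\{i\mid \mathrm{Tr}_{q^2/q}(\omega^i)\in C_1^{(2,q)}\}$. For any odd $d\in\mathbb{Z}_{2q+2}$ put $J_i=I_i-d\pmod{2(q+1)}$ and $X_{1,d}=(I_1\cap J_2)\cup(I_2\cap J_1)$, $X_{3,d}=I_2\cap J_2$. The sets $X_{1,c+q+1},X_{3,c+q+1}$ are those with $d=c+q+1$ reduced modulo $2(q+1)$. It is known that $|X_{1,d}|=2$ and $|X_{1,c}\cap X_{1,c+q+1}|=1$. Let $\psi_{\mathbb{F}_{q^2}}(x)=\zeta_p^{\mathrm{Tr}_{q^2/p}(x)}$ be the canonical additive character ($\zeta_p$ a fixed primitive complex $p$-th root of unity). For $E\subseteq\mathbb{F}_{q^2}\times\mathbb{F}_{q^2}$ put $\psi_{a,b}(E)=\sum_{(x,y)\in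 E}\psi_{\mathbb{F}_{q^2}}(ax+by)$. A set $E\subseteq(\mathbb{F}_{q^2}\times\mathbb{F}_{q^2})\setminus\{(0,0)\}$ closed under multiplication by $\mathbb{F}_q^*$ is of type Q if $|E|=\frac{q^4-1}{4}$ and the values $\psi_{a,b}(E)$, over all $(a,b)\neq(0,0)$, are exactly the two values $\frac{q^2-1}{4}$ and $\frac{-3q^2-1}{4}$. A spread of the $4$-dimensional $\mathbb{F}_q$-space $\mathbb{F}_{q^2}\times\mathbb{F}_{q^2}$ is a collection of $q^2+1$ two-dimensional $\mathbb{F}_q$-subspaces, any two of which intersect only in zero. *)

theory Defs
  imports Complex_Main "HOL-Computational_Algebra.Primes"
begin

text \<open>
  The type variable \<open>'a\<close> plays the role of the field of order \<open>q\<^sup>2\<close>; the cardinality is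
  assumed in the statement.  The subfield of order \<open>q\<close> is the set of fixed points of
  \<open>x \<mapsto> x ^ q\<close>.
\<close>

definition subfield_q :: "nat \<Rightarrow> 'a::finite_field set" where
  "subfield_q q = {x. x ^ q = x}"

definition primitive_element :: "'a::finite_field \<Rightarrow> bool" where
  "primitive_element \<omega> \<longleftrightarrow> range (\<lambda>k::nat. \<omega> ^ k) = UNIV - {0}"

text \<open>
  As \<open>\<omega>\<close> has finite order, natural exponents suffice for the coset
  of the subgroup generated by \<open>\<omega> ^ N\<close>.
\<close>

definition cyc_class :: "'a::finite_field \<Rightarrow> nat \<Rightarrow> nat \<Rightarrow> 'a set" where
  "cyc_class \<omega> N i = {\<omega> ^ i * (\<omega> ^ N) ^ k | k. True}"

definition nonzero_squares_q :: "nat \<Rightarrow> 'a::finite_field set" where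
  "nonzero_squares_q q = {y ^ 2 | y. y \<in> subfield_q q \<and> y \<noteq> 0}"

definition rel_trace :: "nat \<Rightarrow> 'a::finite_field \<Rightarrow> 'a" where
  "rel_trace q x = x + x ^ q"

text \<open>
  Residues modulo \<open>2 * q + 2\<close> are represented by the integers \<open>0, \<dots>, 2 * q + 1\<close>.
  For primitive \<open>\<omega>\<close> the conditions below depend only on the residue of \<open>i\<close>, because
  \<open>\<omega> ^ (2 * q + 2)\<close> is a nonzero square of the field of order \<open>q\<close>.
\<close>

definition I1 :: "'a::finite_field \<Rightarrow> nat \<Rightarrow> int set" where
  "I1 \<omega> q = {i \<in> {0..2 * int q + 1}. rel_trace q (\<omega> powi i) = 0}"

definition I2 :: "'a::finite_field \<Rightarrow> nat \<Rightarrow> int set" where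
  "I2 \<omega> q = {i \<in> {0..2 * int q + 1}. rel_trace q (\<omega> powi i) \<in> nonzero_squares_q q}"

definition shift_mod :: "nat \<Rightarrow> int \<Rightarrow> int set \<Rightarrow> int set" where
  "shift_mod q d I = (\<lambda>i. (i - d) mod (2 * (int q + 1))) ` I"

definition X1 :: "'a::finite_field \<Rightarrow> nat \<Rightarrow> int \<Rightarrow> int set" where
  "X1 \<omega> q d = (I1 \<omega> q \<inter> shift_mod q d (I2 \<omega> q)) \<union> (I2 \<omega> q \<inter> shift_mod q d (I1 \<omega> q))"

definition X3 :: "'a::finite_field \<Rightarrow> nat \<Rightarrow> int \<Rightarrow> int set" where
  "X3 \<omega> q d = I2 \<omega> q \<inter> shift_mod q d (I2 \<omega> q)"

definition primitive_complex_root :: "nat \<Rightarrow> complex \<Rightarrow> bool" where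
  "primitive_complex_root p \<zeta> \<longleftrightarrow> \<zeta> ^ p = 1 \<and> (\<forall>k. 0 < k \<and> k < p \<longrightarrow> \<zeta> ^ k \<noteq> 1)"

definition abs_trace :: "nat \<Rightarrow> nat \<Rightarrow> 'a::finite_field \<Rightarrow> 'a" where
  "abs_trace p m x = (\<Sum>i<m. x ^ (p ^ i))"

text \<open>
  The absolute trace of a field of order \<open>p ^ m\<close> lies in the prime field; in the exponent of
  \<open>\<zeta>\<close> it is read as its representative in \<open>{0..<p}\<close>.
\<close>

definition add_char :: "complex \<Rightarrow> nat \<Rightarrow> nat \<Rightarrow> 'a::finite_field \<Rightarrow> complex" where
  "add_char \<zeta> p m x = \<zeta> ^ (THE k. k < p \<and> of_nat k = abs_trace p m x)"

definition char_sum ::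
    "complex \<Rightarrow> nat \<Rightarrow> nat \<Rightarrow> 'a::finite_field \<Rightarrow> 'a \<Rightarrow> ('a \<times> 'a) set \<Rightarrow> complex" where
  "char_sum \<zeta> p m a b E = (\<Sum>(x, y)\<in>E. add_char \<zeta> p m (a * x + b * y))"

text \<open>Here \<open>q = p ^ n\<close>, and the field \<open>'a\<close> has order \<open>q\<^sup>2 = p ^ (2 * n)\<close>.\<close>

definition type_Q ::
    "complex \<Rightarrow> nat \<Rightarrow> nat \<Rightarrow> ('a::finite_field \<times> 'a) set \<Rightarrow> bool" where
  "type_Q \<zeta> p n E \<longleftrightarrow>
     E \<subseteq> UNIV - {(0, 0)} \<and>
     (\<forall>t \<in> subfield_q (p ^ n) - {0}. \<forall>(x, y) \<in> E. (t * x, t * y) \<in> E) \<and>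
     real (card E) = (real (p ^ n) ^ 4 - 1) / 4 \<and>
     {char_sum \<zeta> p (2 * n) a b E | a b. (a, b) \<noteq> (0, 0)} =
       {(of_nat (p ^ n) ^ 2 - 1) / 4, (- 3 * of_nat (p ^ n) ^ 2 - 1) / 4}"

text \<open>
  Two-dimensional subspaces over the field of order \<open>q\<close>, given by a basis
  \<open>(u1, u2), (v1, v2)\<close>.
\<close>

definition two_dim_subspace :: "nat \<Rightarrow> ('a::finite_field \<times> 'a) set \<Rightarrow> bool" where
  "two_dim_subspace q K \<longleftrightarrow>
     (\<exists>u1 u2 v1 v2.
        (\<forall>s \<in> subfield_q q. \<forall>t \<in> subfield_q q.
           s * u1 + t * v1 = 0 \<and> s * u2 + t * v2 = 0 \<longrightarrow> s = 0 \<and> t = 0) \<and>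
        K = {(s * u1 + t * v1, s * u2 + t * v2) | s t. s \<in> subfield_q q \<and> t \<in> subfield_q q})"

definition is_spread :: "nat \<Rightarrow> ('a::finite_field \<times> 'a) set set \<Rightarrow> bool" where
  "is_spread q S \<longleftrightarrow>
     card S = q ^ 2 + 1 \<and>
     (\<forall>K \<in> S. two_dim_subspace q K) \<and>
     (\<forall>K \<in> S. \<forall>L \<in> S. K \<noteq> L \<longrightarrow> K \<inter> L = {(0, 0)})"

definition spread_family :: "nat \<Rightarrow> ('a::finite_field \<times> 'a) set set" where
  "spread_family q = {{(x, y * x ^ q) | x. True} | y. True} \<union> {{(0, x) | x. True}}"

end

theory Submission
  imports Defs "HOL-Computational_Algebra.Polynomial" "HOL-Number_Theory.Cong"
begin

text \<open>
  Write \<open>\<chi>\<close> and \<open>\<eta>\<close> for the quadratic characters of the fields of order \<open>q ^ 2\<close> and \<open>q\<close>, \<open>T\<close> for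
  the relative trace and \<open>\<delta> = \<omega> powi c\<close>.  Since
  \<open>x * inverse y * \<omega> powi i = \<omega> powi i / y ^ (q + 1) * (x * y) ^ q\<close> for \<open>x\<close> in the small field,
  each of the four sets consists, apart from a coordinate axis, of points \<open>(u, z * u ^ q)\<close> with
  \<open>u \<noteq> 0\<close>, where \<open>\<chi> u\<close> selects one of two sets of slopes \<open>z\<close>, and these sets are given by sign
  conditions on \<open>\<eta> (T z)\<close> and \<open>\<eta> (T (\<delta> * z))\<close>.

  The additive character \<open>\<psi>\<close> is invariant under \<open>x \<mapsto> x ^ q\<close>, hence
  \<open>\<psi> (a * u + b * (z * u ^ q)) = \<psi> (u * (a + (b * z) ^ q))\<close>.  Summing over all \<open>u\<close> with \<open>\<chi> u\<close> fixed
  gives a quadratic Gauss sum, whose value is \<open>q\<close> or \<open>-q\<close>, so with \<open>w = - (a ^ q) / b\<close> the character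
  sum reduces to \<open>\<Sum>z. f z * \<chi> (z - w)\<close>, where \<open>f z\<close> is \<open>1\<close> or \<open>-1\<close> on the two sets of slopes and
  \<open>0\<close> elsewhere.  This \<open>f\<close> splits as \<open>g (T z) + h (T (\<delta> * z))\<close>, and both parts can be evaluated
  because the sum of \<open>\<chi>\<close> over a fibre of \<open>T\<close> only depends on whether the fibre is that of \<open>0\<close>; as
  \<open>\<chi> \<delta> = -1\<close>, the two parts enter with opposite signs.
\<close>

section \<open>Finite sums, signed indicators and a split enumeration\<close>

lemma sum_Collect_eq:
  "(\<Sum>x | P x. f x) = (\<Sum>x\<in>UNIV. if P x then f x else (0 :: 'b::comm_monoid_add))"
  for P :: "'a::finite \<Rightarrow> bool"
  by (simp add: sum.If_cases)

lemma sum_lessThan_add: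
  "(\<Sum>i<m + k. f i) = (\<Sum>i<m. f i) + (\<Sum>i<k. f (m + i :: nat) :: 'b::comm_monoid_add)"
  by (induction k) (simp_all add: add.assoc)

lemma card_eq_sum: "int (card Z) = (\<Sum>z\<in>UNIV. of_bool (z \<in> Z))" for Z :: "'a::finite set"
  by simp

text \<open>Turns the two sums into one sum over the whole field with a sign as weight, so that a
  formula for that sign in terms of traces can be substituted.\<close>

lemma sum_diff_eq:
  fixes f :: "'a::finite \<Rightarrow> int"
  assumes "Z1 \<inter> Z2 = {}"
  shows "(\<Sum>z\<in>Z1. f z) - (\<Sum>z\<in>Z2. f z) = (\<Sum>z\<in>UNIV. (of_bool (z \<in> Z1) - of_bool (z \<in> Z2)) * f z)"
  by (simp add: left_diff_distrib sum_subtractf of_bool_def if_distrib[of "\<lambda>x. x * _"] flip: sum_Collect_eq cong: if_cong)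

text \<open>Enumerates \<open>F\<close> first and \<open>G\<close> afterwards; used to number the
  spread so that each of the two unions is taken over an interval of indices.\<close>

lemma ex_bij_betw_split:
  fixes F G :: "'b set"
  assumes "finite F" "finite G" "F \<inter> G = {}" "card F = m + 1" "card G = N - m" "m \<le> N"
  obtains K where "bij_betw K {0..N} (F \<union> G)" "K ` {0..m} = F" "K ` {m + 1..N} = G"
proof -
  obtain f where f: "bij_betw f {0..m} F"
    using finite_same_card_bij[OF finite_atLeastAtMost assms(1), of 0 m] assms(4) by auto
  have "card {m + 1..N} = card G"
    using assms by simp
  then have "\<exists>g. bij_betw g {m + 1..N} G"
    by (rule finite_same_card_bij[OF finite_atLeastAtMost assms(2)])
  then obtain g where g: "bij_betw g {m + 1..N} G"
    by blast
  define K where "K i = (if i \<le> m then f i else g i)" for i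
  have K1: "bij_betw K {0..m} F"
    using f by (rule bij_betw_cong[THEN iffD1, rotated]) (simp add: K_def)
  have K2: "bij_betw K {m + 1..N} G"
    using g by (rule bij_betw_cong[THEN iffD1, rotated]) (simp add: K_def)
  have "bij_betw K ({0..m} \<union> {m + 1..N}) (F \<union> G)"
    using K1 K2 assms(3) by (rule bij_betw_combine)
  moreover have "{0..m} \<union> {m + 1..N} = {0..N}"
    using assms(6) by auto
  ultimately show ?thesis
    using that K1 K2 by (auto simp: bij_betw_def)
qed

section \<open>Quadratic characters\<close>

definition quad_char :: "'a::finite_field \<Rightarrow> int" where
  "quad_char x = (if x = 0 then 0 else if \<exists>y. x = y ^ 2 then 1 else -1)"

definition quad_char_q :: "nat \<Rightarrow> 'a::finite_field \<Rightarrow> int" where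
  "quad_char_q q s = (if s = 0 then 0 else if s \<in> nonzero_squares_q q then 1 else -1)"

lemma quad_char_0 [simp]: "quad_char 0 = 0"
  by (simp add: quad_char_def)

lemma quad_char_eq_0_iff [simp]: "quad_char x = 0 \<longleftrightarrow> x = 0"
  by (simp add: quad_char_def)

lemma quad_char_cases: "x \<noteq> 0 \<Longrightarrow> quad_char x = 1 \<or> quad_char x = -1"
  by (simp add: quad_char_def)

lemma quad_char_q_0 [simp]: "quad_char_q q 0 = 0"
  by (simp add: quad_char_q_def)

lemma quad_char_q_eq_0_iff [simp]: "quad_char_q q x = 0 \<longleftrightarrow> x = 0"
  by (simp add: quad_char_q_def)

lemma quad_char_q_cases: "x \<noteq> 0 \<Longrightarrow> quad_char_q q x = 1 \<or> quad_char_q q x = -1"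
  by (simp add: quad_char_q_def)

lemma nonzero_squares_q_iff: "x \<in> nonzero_squares_q q \<longleftrightarrow> quad_char_q q x = 1"
  by (auto simp: quad_char_q_def nonzero_squares_q_def)

text \<open>Translation by 1 permutes the field, so adding 1 to every element does not change the
  sum of all elements.\<close>

lemma of_nat_card_UNIV_eq_0: "of_nat (card (UNIV :: 'a::finite_field set)) = (0 :: 'a)"
proof -
  have "(\<Sum>x\<in>UNIV. x + 1 :: 'a) = (\<Sum>x\<in>UNIV. x)"
    by (rule sum.reindex_bij_witness[of _ "\<lambda>x. x - 1" "\<lambda>x. x + 1"]) auto
  then show ?thesis
    by (simp add: sum.distrib)
qed

section \<open>The field of order \<open>q ^ 2\<close>, its subfield of order \<open>q\<close> and
  powers of the primitive element\<close>

locale quadratic_extension =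
  fixes p n q :: nat and \<omega> :: "'a::finite_field"
  assumes prime_p: "prime p" and n_pos: "n > 0" and q_def: "q = p ^ n" and odd_q: "odd q"
    and card_UNIV: "card (UNIV :: 'a set) = q ^ 2"
    and primitive: "primitive_element \<omega>"
begin

abbreviation "Fq \<equiv> subfield_q q :: 'a set"
abbreviation "T \<equiv> rel_trace q :: 'a \<Rightarrow> 'a"
abbreviation "\<eta> \<equiv> quad_char_q q :: 'a \<Rightarrow> int"

lemma q_ge_3: "q \<ge> 3"
proof -
  have "p \<ge> 2"
    using prime_p by (rule prime_ge_2_nat)
  moreover have "p \<le> q"
    using n_pos q_def \<open>p \<ge> 2\<close> by (simp add: self_le_power)
  ultimately show ?thesis
    using odd_q by (cases "q = 2") auto
qed

lemma q_pos: "q > 0"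
  using q_ge_3 by simp

lemma q_square_minus_1: "q ^ 2 - 1 = (q + 1) * (q - 1)"
  by (simp add: power2_eq_square algebra_simps)

lemma q_square_ge_9: "q ^ 2 \<ge> 9"
  using power_mono[OF q_ge_3, of 2] by simp

text \<open>The characteristic is a prime dividing the order of the field, a power of
  \<open>p\<close>.\<close>

lemma CHAR_eq: "CHAR('a) = p"
proof -
  have "CHAR('a) dvd p ^ (n * 2)"
    using of_nat_card_UNIV_eq_0[where 'a = 'a] card_UNIV q_def
    by (simp add: of_nat_eq_0_iff_char_dvd power_mult del: of_nat_power)
  moreover have "prime CHAR('a)"
    by (simp add: prime_CHAR_semidom)
  ultimately show ?thesis
    by (meson prime_dvd_power prime_p primes_dvd_imp_eq)
qed

lemma power_add_p: "(x + y :: 'a) ^ (p ^ k) = x ^ (p ^ k) + y ^ (p ^ k)"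
  by (rule freshmans_dream') (simp_all add: CHAR_eq prime_p)

lemma power_add_q: "(x + y :: 'a) ^ q = x ^ q + y ^ q"
  unfolding q_def by (rule power_add_p)

lemma power_minus_q: "(- x :: 'a) ^ q = - (x ^ q)"
  using odd_q by (rule power_minus_odd)

lemma power_diff_q: "(x - y :: 'a) ^ q = x ^ q - y ^ q"
  using power_add_q[of x "- y"] by (simp add: power_minus_q)

lemma power_q_q: "(x ^ q) ^ q = (x :: 'a)"
  using finite_field_power_card_eq_same[of x]
  by (simp add: card_UNIV power_mult power2_eq_square)

lemma mem_Fq: "x \<in> Fq \<longleftrightarrow> x ^ q = x"
  by (simp add: subfield_q_def)

lemma Fq_0 [simp]: "0 \<in> Fq" and Fq_1 [simp]: "1 \<in> Fq"
  using q_pos by (simp_all add: mem_Fq)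

lemma Fq_add: "x \<in> Fq \<Longrightarrow> y \<in> Fq \<Longrightarrow> x + y \<in> Fq"
  and Fq_diff: "x \<in> Fq \<Longrightarrow> y \<in> Fq \<Longrightarrow> x - y \<in> Fq"
  and Fq_mult: "x \<in> Fq \<Longrightarrow> y \<in> Fq \<Longrightarrow> x * y \<in> Fq"
  and Fq_inverse: "x \<in> Fq \<Longrightarrow> inverse x \<in> Fq"
  and Fq_divide: "x \<in> Fq \<Longrightarrow> y \<in> Fq \<Longrightarrow> x / y \<in> Fq"
  and Fq_power: "x \<in> Fq \<Longrightarrow> x ^ k \<in> Fq"
  by (simp_all add: mem_Fq power_add_q power_diff_q power_mult_distrib power_inverse power_divide
      flip: power_mult)
     (metis mult.commute power_mult)

lemma T_in_Fq: "T x \<in> Fq"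
  by (simp add: mem_Fq rel_trace_def power_add_q power_q_q add.commute)

lemma T_add: "T (x + y) = T x + T y" and T_diff: "T (x - y) = T x - T y"
  by (simp_all add: rel_trace_def power_add_q power_diff_q)

lemma T_mult: "r \<in> Fq \<Longrightarrow> T (r * x) = r * T x"
  by (simp add: rel_trace_def power_mult_distrib mem_Fq algebra_simps)

lemma T_0 [simp]: "T 0 = 0"
  using q_pos by (simp add: rel_trace_def)

lemma omega_neq_0 [simp]: "\<omega> \<noteq> 0"
proof
  assume "\<omega> = 0"
  then have "UNIV - {0 :: 'a} \<subseteq> {1}"
    using primitive by (auto simp: primitive_element_def power_0_left)
  then have "card (UNIV - {0 :: 'a}) \<le> card {1 :: 'a}"
    by (intro card_mono) auto
  then show False
    using q_square_ge_9 by (simp add: card_Diff_singleton card_UNIV)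
qed

lemma nonzero_powerE:
  assumes "x \<noteq> (0 :: 'a)"
  obtains k where "x = \<omega> ^ k"
  using primitive assms by (auto simp: primitive_element_def)

lemma power_N_eq_1: "x \<noteq> 0 \<Longrightarrow> (x :: 'a) ^ (q ^ 2 - 1) = 1"
proof -
  assume x: "x \<noteq> 0"
  have "x * x ^ (q ^ 2 - 1) = x ^ Suc (q ^ 2 - 1)"
    by (rule power_Suc[symmetric])
  also have "Suc (q ^ 2 - 1) = q ^ 2"
    using q_pos by simp
  also have "x ^ q ^ 2 = x * 1"
    using finite_field_power_card_eq_same[of x] card_UNIV by simp
  finally show ?thesis
    using x by simp
qed

lemma omega_power_mod: "\<omega> ^ (k mod (q ^ 2 - 1)) = \<omega> ^ k"
proof -
  have "\<omega> ^ k = \<omega> ^ ((q ^ 2 - 1) * (k div (q ^ 2 - 1)) + k mod (q ^ 2 - 1))"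
    by simp
  also have "\<dots> = \<omega> ^ (k mod (q ^ 2 - 1))"
    unfolding power_add power_mult by (simp only: power_N_eq_1[OF omega_neq_0]) simp
  finally show ?thesis ..
qed

text \<open>Exponents can be reduced modulo \<open>q ^ 2 - 1\<close>, so these powers already cover
  all \<open>q ^ 2 - 1\<close> nonzero elements; counting gives injectivity.\<close>

lemma inj_on_omega_power: "inj_on (\<lambda>k. \<omega> ^ k) {..<q ^ 2 - 1}"
proof (rule eq_card_imp_inj_on)
  have N: "q ^ 2 - 1 > 0"
    using q_square_ge_9 by simp
  have "(\<lambda>k. \<omega> ^ k) ` {..<q ^ 2 - 1} = UNIV - {0}"
  proof
    show "UNIV - {0} \<subseteq> (\<lambda>k. \<omega> ^ k) ` {..<q ^ 2 - 1}"
    proof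
      fix x :: 'a assume "x \<in> UNIV - {0}"
      then obtain k where "x = \<omega> ^ k"
        using nonzero_powerE by auto
      then have "x = \<omega> ^ (k mod (q ^ 2 - 1))"
        by (simp only: omega_power_mod)
      then show "x \<in> (\<lambda>k. \<omega> ^ k) ` {..<q ^ 2 - 1}"
        by (rule image_eqI) (rule lessThan_iff[THEN iffD2, OF mod_less_divisor[OF N]])
    qed
  qed auto
  then show "card ((\<lambda>k. \<omega> ^ k) ` {..<q ^ 2 - 1}) = card {..<q ^ 2 - 1}"
    by (simp add: card_Diff_singleton card_UNIV)
qed simp

lemma omega_power_eq_iff: "\<omega> ^ j = \<omega> ^ k \<longleftrightarrow> j mod (q ^ 2 - 1) = k mod (q ^ 2 - 1)"
proof
  have N: "q ^ 2 - 1 > 0"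
    using q_square_ge_9 by simp
  have mem: "i mod (q ^ 2 - 1) \<in> {..<q ^ 2 - 1}" for i
    by (rule lessThan_iff[THEN iffD2]) (rule mod_less_divisor[OF N])
  assume eq: "\<omega> ^ j = \<omega> ^ k"
  have "\<omega> ^ (j mod (q ^ 2 - 1)) = \<omega> ^ (k mod (q ^ 2 - 1))"
    by (rule trans[OF omega_power_mod trans[OF eq omega_power_mod[symmetric]]])
  then show "j mod (q ^ 2 - 1) = k mod (q ^ 2 - 1)"
    by (rule inj_onD[OF inj_on_omega_power _ mem mem])
next
  assume eq: "j mod (q ^ 2 - 1) = k mod (q ^ 2 - 1)"
  show "\<omega> ^ j = \<omega> ^ k"
    using omega_power_mod[of j] omega_power_mod[of k] unfolding eq by (metis)
qed

lemma omega_power_eq_1_iff: "\<omega> ^ k = 1 \<longleftrightarrow> q ^ 2 - 1 dvd k"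
  by (rule trans[OF omega_power_eq_iff[of k 0, unfolded power_0 mod_0] dvd_eq_mod_eq_0[symmetric]])

lemma even_q_square_minus_1: "even (q ^ 2 - 1)"
  using odd_q by simp

text \<open>Squares are exactly the even powers of \<omega>; the parity of an exponent is well
  defined because \<open>q ^ 2 - 1\<close> is even.\<close>

lemma quad_char_omega_power: "quad_char (\<omega> ^ k) = (- 1) ^ k"
proof (cases "even k")
  case True
  then have "\<exists>y. \<omega> ^ k = y ^ 2"
    by (auto elim!: evenE intro!: exI[of _ "\<omega> ^ (k div 2)"] simp: mult.commute simp flip: power_mult)
  then show ?thesis
    using True by (simp add: quad_char_def)
next
  case False
  have "\<nexists>y. \<omega> ^ k = y ^ 2"
  proof
    assume "\<exists>y. \<omega> ^ k = y ^ 2"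
    then obtain y where y: "\<omega> ^ k = y ^ 2" ..
    then have "y \<noteq> 0"
      by auto
    then obtain j where "y = \<omega> ^ j"
      by (rule nonzero_powerE)
    then have "y ^ 2 = \<omega> ^ (2 * j)"
      by (simp add: mult.commute flip: power_mult)
    with y have "k mod (q ^ 2 - 1) = 2 * j mod (q ^ 2 - 1)"
      by (simp only: omega_power_eq_iff)
    then have "even k \<longleftrightarrow> even (2 * j)"
      by (metis dvd_mod_iff even_q_square_minus_1)
    then show False
      using False by simp
  qed
  then show ?thesis
    using False by (simp add: quad_char_def)
qed

lemma quad_char_mult: "quad_char (x * y :: 'a) = quad_char x * quad_char y"
proof (cases "x = 0 \<or> y = 0")
  case False
  then obtain j k where "x = \<omega> ^ j" "y = \<omega> ^ k"
    by (meson nonzero_powerE)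
  then show ?thesis
    by (simp add: quad_char_omega_power flip: power_add)
qed auto

lemma quad_char_1 [simp]: "quad_char (1 :: 'a) = 1"
  using quad_char_omega_power[of 0] by simp

lemma quad_char_omega [simp]: "quad_char \<omega> = - 1"
  using quad_char_omega_power[of 1] by simp

lemma quad_char_power: "quad_char ((x :: 'a) ^ k) = quad_char x ^ k"
  by (induction k) (simp_all add: quad_char_mult)

lemma quad_char_power_q: "quad_char ((x :: 'a) ^ q) = quad_char x"
proof (cases "x = 0")
  case False
  then show ?thesis
    using quad_char_cases[of x] odd_q by (auto simp: quad_char_power)
qed (use q_pos in simp)

text \<open>Being fixed by \<open>x ^ q\<close> means \<open>\<omega> ^ (k * (q - 1)) = 1\<close>,
  and \<omega> has order \<open>(q + 1) * (q - 1)\<close>.\<close>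

lemma Fq_omega_power_iff: "\<omega> ^ k \<in> Fq \<longleftrightarrow> q + 1 dvd k"
proof -
  have "\<omega> ^ k \<in> Fq \<longleftrightarrow> \<omega> ^ k * \<omega> ^ (k * (q - 1)) = \<omega> ^ k"
    using q_pos by (simp add: mem_Fq algebra_simps flip: power_mult power_add)
  also have "\<dots> \<longleftrightarrow> \<omega> ^ (k * (q - 1)) = 1"
    by simp
  also have "\<dots> \<longleftrightarrow> (q + 1) * (q - 1) dvd k * (q - 1)"
    by (simp only: omega_power_eq_1_iff q_square_minus_1)
  also have "\<dots> \<longleftrightarrow> q + 1 dvd k"
    using q_ge_3 by (intro dvd_times_right_cancel_iff) simp
  finally show ?thesis .
qed

lemma Fq_nonzeroE:
  assumes "r \<in> Fq" "r \<noteq> 0"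
  obtains k where "r = \<omega> ^ ((q + 1) * k)"
  using assms by (metis nonzero_powerE Fq_omega_power_iff dvdE)

text \<open>Nonzero elements of the small field are powers of \<open>\<omega> ^ (q + 1)\<close>, and
  \<open>q + 1\<close> is even: they all become squares in the large field. Most invariance
  arguments below rest on this.\<close>

lemma quad_char_Fq:
  assumes "r \<in> Fq" "r \<noteq> 0"
  shows "quad_char r = 1"
proof -
  obtain k where "r = \<omega> ^ ((q + 1) * k)"
    using assms by (rule Fq_nonzeroE)
  then have "quad_char r = (- 1) ^ ((q + 1) * k)"
    by (simp only: quad_char_omega_power)
  then show ?thesis
    using odd_q by (simp only: power_mult) simp
qed

text \<open>\<open>\<omega> ^ (q + 1)\<close> generates the nonzero elements of the small field, and
  parity of \<open>k\<close> is well defined because \<open>q - 1\<close> is even.\<close>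

lemma eta_omega_power: "\<eta> (\<omega> ^ ((q + 1) * k)) = (- 1) ^ k"
proof (cases "even k")
  case True
  then obtain j where "k = 2 * j" ..
  then have "\<omega> ^ ((q + 1) * k) = (\<omega> ^ ((q + 1) * j)) ^ 2"
    by (simp add: mult_ac flip: power_mult)
  moreover have "\<omega> ^ ((q + 1) * j) \<in> Fq"
    by (simp only: Fq_omega_power_iff dvd_triv_left)
  ultimately have "\<omega> ^ ((q + 1) * k) \<in> nonzero_squares_q q"
    unfolding nonzero_squares_q_def by (intro CollectI exI[of _ "\<omega> ^ ((q + 1) * j)"]) simp
  then show ?thesis
    using True by (simp only: nonzero_squares_q_iff) simp
next
  case False
  have "\<omega> ^ ((q + 1) * k) \<notin> nonzero_squares_q q"
  proof
    assume "\<omega> ^ ((q + 1) * k) \<in> nonzero_squares_q q"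
    then obtain y where y: "\<omega> ^ ((q + 1) * k) = y ^ 2" "y \<in> Fq" "y \<noteq> 0"
      by (auto simp: nonzero_squares_q_def)
    then obtain j where "y = \<omega> ^ ((q + 1) * j)"
      by (meson Fq_nonzeroE)
    with y have *: "\<omega> ^ ((q + 1) * k) = \<omega> ^ ((q + 1) * (2 * j))"
      by (simp add: mult_ac flip: power_mult)
    then have "(q + 1) * (k mod (q - 1)) = (q + 1) * (2 * j mod (q - 1))"
      by (simp only: omega_power_eq_iff q_square_minus_1 mult_mod_right)
    then have "k mod (q - 1) = 2 * j mod (q - 1)"
      by (simp only: mult_cancel1) simp
    moreover have "even (q - 1)"
      using odd_q by simp
    ultimately have "even k \<longleftrightarrow> even (2 * j)"
      by (metis dvd_mod_iff)
    then show False
      using False by simp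
  qed
  then show ?thesis
    using False by (simp add: quad_char_q_def)
qed

lemma eta_mult: "r \<in> Fq \<Longrightarrow> s \<in> Fq \<Longrightarrow> \<eta> (r * s) = \<eta> r * \<eta> s"
proof (cases "r = 0 \<or> s = 0")
  case False
  moreover assume "r \<in> Fq" "s \<in> Fq"
  ultimately obtain j k where jk: "r = \<omega> ^ ((q + 1) * j)" "s = \<omega> ^ ((q + 1) * k)"
    by (meson Fq_nonzeroE)
  then have "r * s = \<omega> ^ ((q + 1) * (j + k))"
    by (simp add: algebra_simps flip: power_add)
  then show ?thesis
    unfolding jk by (simp only: eta_omega_power power_add)
qed auto

lemma eta_power: "r \<in> Fq \<Longrightarrow> \<eta> (r ^ k) = \<eta> r ^ k"
proof (induction k)
  case 0
  show ?case
    using eta_omega_power[of 0] by simp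
next
  case (Suc k)
  then show ?case
    by (simp add: eta_mult Fq_power)
qed

lemma card_Fq: "card Fq = q"
proof -
  have "bij_betw (\<lambda>k. \<omega> ^ ((q + 1) * k)) {..<q - 1} (Fq - {0})"
    unfolding bij_betw_def
  proof
    show inj: "inj_on (\<lambda>k. \<omega> ^ ((q + 1) * k)) {..<q - 1}"
    proof (rule inj_onI)
      fix j k assume jk: "j \<in> {..<q - 1}" "k \<in> {..<q - 1}"
        and eq: "\<omega> ^ ((q + 1) * j) = \<omega> ^ ((q + 1) * k)"
      have "(q + 1) * j \<in> {..<q ^ 2 - 1}" "(q + 1) * k \<in> {..<q ^ 2 - 1}"
        unfolding q_square_minus_1 lessThan_iff using jk by (auto simp del: mult_Suc add_Suc_right)
      then have "(q + 1) * j = (q + 1) * k"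
        using inj_on_omega_power eq by (auto dest: inj_onD)
      then show "j = k"
        by (metis add_is_0 mult_left_cancel one_neq_zero)
    qed
    show "(\<lambda>k. \<omega> ^ ((q + 1) * k)) ` {..<q - 1} = Fq - {0}"
    proof
      show "(\<lambda>k. \<omega> ^ ((q + 1) * k)) ` {..<q - 1} \<subseteq> Fq - {0}"
        by (auto simp only: Fq_omega_power_iff dvd_triv_left omega_neq_0 power_eq_0_iff image_iff
            Diff_iff singleton_iff)
      show "Fq - {0} \<subseteq> (\<lambda>k. \<omega> ^ ((q + 1) * k)) ` {..<q - 1}"
      proof
        fix r assume "r \<in> Fq - {0}"
        then obtain k where k: "r = \<omega> ^ ((q + 1) * k)"
          by (auto elim: Fq_nonzeroE)
        have "r = \<omega> ^ (((q + 1) * k) mod (q ^ 2 - 1))"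
          by (simp only: omega_power_mod k)
        also have "((q + 1) * k) mod (q ^ 2 - 1) = (q + 1) * (k mod (q - 1))"
          by (simp only: q_square_minus_1 mult_mod_right)
        finally show "r \<in> (\<lambda>k. \<omega> ^ ((q + 1) * k)) ` {..<q - 1}"
          using q_ge_3 by auto
      qed
    qed
  qed
  then have "card (Fq - {0}) = q - 1"
    by (auto dest: bij_betw_same_card)
  then show ?thesis
    using q_ge_3 by (simp add: card_Diff_singleton_if)
qed

end

context quadratic_extension
begin

section \<open>Sums over the fibres of the trace\<close>

text \<open>The substitution of \<open>\<omega> * z\<close> for \<open>z\<close> reverses the sign
  of every term.\<close>

lemma sum_quad_char: "(\<Sum>z\<in>UNIV. quad_char (z :: 'a)) = 0"
proof -
  have "(\<Sum>z\<in>UNIV. quad_char (z :: 'a)) = (\<Sum>z\<in>UNIV. quad_char (\<omega> * z))"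
    by (rule sum.reindex_bij_witness[of _ "\<lambda>z. \<omega> * z" "\<lambda>z. z / \<omega>"]) auto
  then show ?thesis
    by (simp add: quad_char_mult sum_negf)
qed

lemma sum_eta: "(\<Sum>s\<in>Fq. \<eta> s) = 0"
proof -
  define \<nu> where "\<nu> = \<omega> ^ (q + 1)"
  have \<nu>: "\<nu> \<in> Fq" "\<nu> \<noteq> 0" "\<eta> \<nu> = - 1"
    using Fq_omega_power_iff[of "q + 1"] eta_omega_power[of 1] by (simp_all add: \<nu>_def)
  have "(\<Sum>s\<in>Fq. \<eta> s) = (\<Sum>s\<in>Fq. \<eta> (\<nu> * s))"
    by (rule sum.reindex_bij_witness[of _ "\<lambda>z. \<nu> * z" "\<lambda>z. z / \<nu>"])
       (use \<nu> in \<open>auto simp: Fq_mult Fq_divide\<close>)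
  also have "\<dots> = - (\<Sum>s\<in>Fq. \<eta> s)"
    by (simp add: eta_mult \<nu> sum_negf)
  finally show ?thesis
    by simp
qed

text \<open>The quadratic character of \<theta> below, and the sign of the quadratic Gauss sum: 1
  for q = 3 mod 4 and -1 for q = 1 mod 4.\<close>

definition eps :: int where
  "eps = (- 1) ^ ((q + 1) div 2)"

lemma eps_square [simp]: "eps * eps = 1"
  by (simp add: eps_def flip: power_add)

text \<open>A spanning vector of the kernel of the trace over the small field.\<close>

definition \<theta> :: 'a where
  "\<theta> = \<omega> ^ ((q + 1) div 2)"

lemma theta_neq_0 [simp]: "\<theta> \<noteq> 0"
  by (simp add: \<theta>_def)

lemma quad_char_theta: "quad_char \<theta> = eps"
  by (simp add: \<theta>_def eps_def quad_char_omega_power)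

text \<open>\<open>\<theta> ^ (q - 1)\<close> squares to \<open>\<omega> ^ (q ^ 2 - 1) = 1\<close>,
  and it is not 1 because its exponent as a power of \<omega> is positive and smaller than the order
  of \<omega>. Hence it is -1.\<close>

lemma theta_power_q: "\<theta> ^ q = - \<theta>"
proof -
  define h where "h = (q + 1) div 2"
  have h: "q + 1 = 2 * h" "h > 0"
    using odd_q q_ge_3 by (auto simp: h_def)
  have "\<theta> ^ (q - 1) \<noteq> 1"
  proof
    assume "\<theta> ^ (q - 1) = 1"
    then have "(q + 1) * (q - 1) dvd h * (q - 1)"
      by (simp only: \<theta>_def h_def omega_power_eq_1_iff q_square_minus_1 flip: power_mult)
    moreover have "h * (q - 1) > 0"
      using h q_ge_3 by simp
    ultimately have "(q + 1) * (q - 1) \<le> h * (q - 1)"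
      by (rule dvd_imp_le)
    then have "q + 1 \<le> h"
      using q_ge_3 by (simp only: mult_le_cancel2)
    then show False
      using h q_ge_3 by simp
  qed
  moreover have "(\<theta> ^ (q - 1)) ^ 2 = \<omega> ^ ((2 * h) * (q - 1))"
    by (simp add: \<theta>_def h_def mult_ac flip: power_mult)
  then have "(\<theta> ^ (q - 1)) ^ 2 = 1"
    by (simp only: h(1)[symmetric] q_square_minus_1[symmetric] power_N_eq_1[OF omega_neq_0])
  ultimately have "\<theta> ^ (q - 1) = - 1"
    by (simp add: power2_eq_1_iff)
  then show ?thesis
    using power_Suc[of \<theta> "q - 1"] q_pos by simp
qed

text \<open>A zero trace means \<open>z ^ q = - z\<close>; as \<theta> satisfies the same equation,
  the quotient is fixed by the \<open>q\<close>-th power map.\<close>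

lemma T_eq_0_iff: "T z = 0 \<longleftrightarrow> z / \<theta> \<in> Fq"
proof -
  have "z / \<theta> \<in> Fq \<longleftrightarrow> - (z ^ q) / \<theta> = z / \<theta>"
    by (simp add: mem_Fq power_divide theta_power_q)
  also have "\<dots> \<longleftrightarrow> - (z ^ q) = z"
    by (simp only: divide_cancel_right theta_neq_0 simp_thms)
  also have "\<dots> \<longleftrightarrow> T z = 0"
    unfolding rel_trace_def by (metis add.commute add_eq_0_iff)
  finally show ?thesis ..
qed

lemma T_1: "T 1 \<noteq> 0"
proof
  assume "T 1 = 0"
  then have "of_nat 2 = (0 :: 'a)"
    by (simp add: rel_trace_def)
  then have "p dvd 2"
    by (simp only: of_nat_eq_0_iff_char_dvd CHAR_eq)
  then have "p = 2"
    using prime_p by (simp add: primes_dvd_imp_eq)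
  then show False
    using odd_q n_pos by (simp add: q_def)
qed

definition fibre_sum :: "'a \<Rightarrow> int" where
  "fibre_sum s = (\<Sum>z | T z = s. quad_char z)"

text \<open>The kernel consists of the multiples \<open>r * \<theta>\<close> with \<open>r\<close>
  in the small field, and for nonzero \<open>r\<close> the factor \<open>r\<close> does not affect
  the character.\<close>

lemma fibre_sum_0: "fibre_sum 0 = eps * (int q - 1)"
proof -
  have "fibre_sum 0 = (\<Sum>r\<in>Fq. quad_char (r * \<theta>))"
    unfolding fibre_sum_def
    by (rule sum.reindex_bij_witness[of _ "\<lambda>r. r * \<theta>" "\<lambda>z. z / \<theta>"])
       (auto simp: T_eq_0_iff)
  also have "\<dots> = (\<Sum>r\<in>Fq - {0}. quad_char (r * \<theta>))"
    by (rule sum.mono_neutral_right) auto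
  also have "\<dots> = (\<Sum>r\<in>Fq - {0}. eps)"
    by (rule sum.cong) (auto simp: quad_char_mult quad_char_Fq quad_char_theta)
  also have "\<dots> = eps * (int q - 1)"
    using q_pos by (simp add: card_Fq of_nat_diff card_Diff_singleton)
  finally show ?thesis .
qed

text \<open>Multiplication by \<open>r\<close> carries the fibre of \<open>s\<close> to that of
  \<open>r * s\<close> and preserves the character, since \<open>r\<close> is a square in the large
  field.\<close>

lemma fibre_sum_mult:
  assumes "r \<in> Fq" "r \<noteq> 0"
  shows "fibre_sum (r * s) = fibre_sum s"
  unfolding fibre_sum_def
  by (rule sum.reindex_bij_witness[of _ "\<lambda>z. r * z" "\<lambda>z. inverse r * z"])
     (use assms in \<open>auto simp: T_mult Fq_inverse quad_char_mult quad_char_Fq simp flip: mult.assoc\<close>)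

lemma sum_fibre_sum: "(\<Sum>s\<in>Fq. fibre_sum s) = 0"
  unfolding fibre_sum_def
  using sum.group[of UNIV Fq T quad_char] T_in_Fq sum_quad_char by auto

text \<open>The \<open>q - 1\<close> nonzero fibres have equal sums by scaling, and the sums of all
  fibres add up to 0.\<close>

lemma fibre_sum_nonzero:
  assumes "s \<in> Fq" "s \<noteq> 0"
  shows "fibre_sum s = - eps"
proof -
  have "fibre_sum r = fibre_sum s" if "r \<in> Fq - {0}" for r
    using fibre_sum_mult[of "r / s" s] that assms by (simp add: Fq_divide)
  then have "(\<Sum>r\<in>Fq - {0}. fibre_sum r) = (int q - 1) * fibre_sum s"
    using q_pos by (simp add: card_Fq of_nat_diff card_Diff_singleton)
  moreover have "(\<Sum>r\<in>Fq. fibre_sum r) = fibre_sum 0 + (\<Sum>r\<in>Fq - {0}. fibre_sum r)"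
    by (rule sum.remove) auto
  ultimately have "(int q - 1) * (fibre_sum s + eps) = 0"
    by (simp add: sum_fibre_sum fibre_sum_0 algebra_simps)
  then show ?thesis
    using q_ge_3 by simp
qed

text \<open>Grouping by the trace and translating by \<open>w\<close> leaves
  \<open>g s * fibre_sum (s - T w)\<close>. The fibre sum is \<open>- eps\<close> everywhere, with
  an extra \<open>eps * q\<close> at 0, so \<open>g (T w)\<close> is singled out.\<close>

lemma sum_trace_quad_char:
  fixes g :: "'a \<Rightarrow> int"
  shows "(\<Sum>z\<in>UNIV. g (T z) * quad_char (z - w)) = eps * (int q * g (T w) - (\<Sum>s\<in>Fq. g s))"
proof -
  have "(\<Sum>z\<in>UNIV. g (T z) * quad_char (z - w))
      = (\<Sum>s\<in>Fq. \<Sum>z | T z = s. g (T z) * quad_char (z - w))"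
    using sum.group[of UNIV Fq T "\<lambda>z. g (T z) * quad_char (z - w)"] T_in_Fq
    by (simp add: image_subset_iff)
  also have "\<dots> = (\<Sum>s\<in>Fq. g s * fibre_sum (s - T w))"
  proof (rule sum.cong[OF refl])
    fix s
    have "(\<Sum>z | T z = s. g (T z) * quad_char (z - w)) = (\<Sum>z | T z = s. g s * quad_char (z - w))"
      by (rule sum.cong) auto
    also have "(\<Sum>z | T z = s. g s * quad_char (z - w)) = (\<Sum>z | T z = s - T w. g s * quad_char z)"
      by (rule sum.reindex_bij_witness[of _ "\<lambda>z. z + w" "\<lambda>z. z - w"]) (auto simp: T_add T_diff)
    finally show "(\<Sum>z | T z = s. g (T z) * quad_char (z - w)) = g s * fibre_sum (s - T w)"
      by (simp add: fibre_sum_def sum_distrib_left)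
  qed
  also have "\<dots> = (\<Sum>s\<in>Fq. (if s = T w then eps * int q * g s else 0) - eps * g s)"
    by (rule sum.cong) (auto simp: fibre_sum_0 fibre_sum_nonzero Fq_diff T_in_Fq algebra_simps)
  also have "\<dots> = eps * int q * g (T w) - eps * (\<Sum>s\<in>Fq. g s)"
    by (simp add: sum_subtractf T_in_Fq sum_distrib_left)
  finally show ?thesis
    by (simp add: algebra_simps)
qed

section \<open>The additive character\<close>

text \<open>Transitivity of traces: the upper half of the exponents contributes the same sum for
  \<open>x ^ q\<close>.\<close>

lemma abs_trace_eq: "abs_trace p (2 * n) x = (\<Sum>i<n. T x ^ (p ^ i))"
proof -
  have "abs_trace p (2 * n) x = (\<Sum>i<n. x ^ (p ^ i)) + (\<Sum>i<n. x ^ (p ^ (n + i)))"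
    by (simp add: abs_trace_def mult_2 sum_lessThan_add)
  also have "\<dots> = (\<Sum>i<n. T x ^ (p ^ i))"
    by (simp add: rel_trace_def power_add_p q_def power_mult power_add flip: sum.distrib)
  finally show ?thesis .
qed

lemma abs_trace_add: "abs_trace p (2 * n) (x + y :: 'a) = abs_trace p (2 * n) x + abs_trace p (2 * n) y"
  by (simp add: abs_trace_def power_add_p sum.distrib)

lemma abs_trace_power_q: "abs_trace p (2 * n) (x ^ q :: 'a) = abs_trace p (2 * n) x"
  by (simp add: abs_trace_eq rel_trace_def power_q_q add.commute)

text \<open>Raising to the power \<open>p\<close> permutes the summands cyclically, the last one
  wrapping around to \<open>x\<close>.\<close>

lemma abs_trace_power_p: "abs_trace p (2 * n) (x :: 'a) ^ p = abs_trace p (2 * n) x"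
proof -
  have "x ^ (p ^ (2 * n)) = x"
    using power_q_q[of x] by (simp add: q_def mult_2 power_add flip: power_mult)
  have "abs_trace p (2 * n) x ^ p = (\<Sum>i<2 * n. x ^ (p ^ Suc i))"
    unfolding abs_trace_def
    by (subst freshmans_dream_sum) (simp_all add: CHAR_eq prime_p mult.commute flip: power_mult)
  also have "x + \<dots> = (\<Sum>i<Suc (2 * n). x ^ (p ^ i))"
    by (subst sum.lessThan_Suc_shift) simp
  then have "(\<Sum>i<2 * n. x ^ (p ^ Suc i)) = abs_trace p (2 * n) x"
    using \<open>x ^ (p ^ (2 * n)) = x\<close> by (simp add: abs_trace_def add.commute)
  finally show ?thesis .
qed

text \<open>The \<open>p\<close> residues are roots of \<open>X ^ p - X\<close>, which has at most
  \<open>p\<close> roots. This makes the definite description in \<open>add_char\<close>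
  meaningful.\<close>

lemma prime_field_eq: "{y :: 'a. y ^ p = y} = of_nat ` {..<p}"
proof (rule sym, rule card_seteq)
  have p: "p > 1"
    using prime_p by (rule prime_gt_1_nat)
  have "(of_nat k :: 'a) ^ p = of_nat k" for k
  proof (induction k)
    case (Suc k)
    then show ?case
      using power_add_p[of 1 "of_nat k" 1] by simp
  qed (use p in simp)
  then show "of_nat ` {..<p} \<subseteq> {y :: 'a. y ^ p = y}"
    by auto
  have "inj_on (of_nat :: nat \<Rightarrow> 'a) {..<p}"
    by (auto intro!: inj_onI simp: of_nat_eq_iff_cong_CHAR CHAR_eq cong_def)
  then have "card ((of_nat :: nat \<Rightarrow> 'a) ` {..<p}) = p"
    by (simp add: card_image)
  moreover have "card {y :: 'a. y ^ p = y} \<le> p"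
  proof -
    define P :: "'a poly" where "P = monom 1 p - monom 1 1"
    have "coeff P p = 1"
      using p by (simp add: P_def)
    then have "P \<noteq> 0"
      by auto
    have "degree P \<le> p"
      unfolding P_def using p by (intro degree_diff_le) (auto simp: degree_monom_eq)
    moreover have "card {y. poly P y = 0} \<le> degree P"
      using \<open>P \<noteq> 0\<close> by (rule card_poly_roots_bound)
    moreover have "{y. poly P y = 0} = {y. y ^ p = y}"
      by (simp add: P_def poly_monom)
    ultimately show ?thesis
      by simp
  qed
  ultimately show "card {y :: 'a. y ^ p = y} \<le> card ((of_nat :: nat \<Rightarrow> 'a) ` {..<p})"
    by simp
qed simp

end

locale quadratic_extension_char = quadratic_extension +
  fixes \<zeta> :: complex
  assumes root: "primitive_complex_root p \<zeta>"
begin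

abbreviation "\<psi> \<equiv> add_char \<zeta> p (2 * n) :: 'a \<Rightarrow> complex"

lemma zeta_power_p: "\<zeta> ^ p = 1"
  using root by (simp add: primitive_complex_root_def)

lemma zeta_power_mod: "\<zeta> ^ (k mod p) = \<zeta> ^ k"
proof -
  have "\<zeta> ^ k = \<zeta> ^ (p * (k div p) + k mod p)"
    by simp
  also have "\<dots> = \<zeta> ^ (k mod p)"
    unfolding power_add power_mult by (simp add: zeta_power_p)
  finally show ?thesis ..
qed

lemma of_nat_mod_p: "of_nat (k mod p) = (of_nat k :: 'a)"
  by (simp add: of_nat_eq_iff_cong_CHAR CHAR_eq cong_def)

text \<open>Removes the definite description: any representative of the trace may serve as exponent,
  as \<zeta> has \<open>p\<close>-th power 1.\<close>

lemma psi_eqI: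
  assumes "of_nat k = abs_trace p (2 * n) x"
  shows "\<psi> x = \<zeta> ^ k"
proof -
  have "p > 0"
    using prime_p by (rule prime_gt_0_nat)
  have "(THE k. k < p \<and> of_nat k = abs_trace p (2 * n) x) = k mod p"
    using assms \<open>p > 0\<close>
    by (intro the_equality)
       (auto simp: of_nat_mod_p of_nat_eq_iff_cong_CHAR CHAR_eq cong_def
         simp flip: assms)
  then show ?thesis
    by (simp add: add_char_def zeta_power_mod)
qed

lemma abs_traceE:
  obtains k where "k < p" "of_nat k = abs_trace p (2 * n) (x :: 'a)"
proof -
  have "abs_trace p (2 * n) x \<in> {y. y ^ p = y}"
    by (simp add: abs_trace_power_p)
  then show ?thesis
    unfolding prime_field_eq using that by auto
qed

lemma psi_add: "\<psi> (x + y) = \<psi> x * \<psi> y"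
proof -
  obtain j k where "of_nat j = abs_trace p (2 * n) x" "of_nat k = abs_trace p (2 * n) y"
    by (meson abs_traceE)
  moreover from this have "of_nat (j + k) = abs_trace p (2 * n) (x + y)"
    by (simp add: abs_trace_add)
  ultimately show ?thesis
    by (simp only: psi_eqI power_add)
qed

lemma psi_eq_1_iff: "\<psi> x = 1 \<longleftrightarrow> abs_trace p (2 * n) x = 0"
proof -
  obtain k where k: "k < p" "of_nat k = abs_trace p (2 * n) x"
    by (rule abs_traceE)
  have "\<psi> x = \<zeta> ^ k"
    using k(2) by (rule psi_eqI)
  also have "\<zeta> ^ k = 1 \<longleftrightarrow> k = 0"
    using root k(1) by (auto simp: primitive_complex_root_def)
  also have "\<dots> \<longleftrightarrow> of_nat k = (0 :: 'a)"
    using k(1) by (auto simp: of_nat_eq_0_iff_char_dvd CHAR_eq dest: dvd_imp_le)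
  finally show ?thesis
    by (simp only: k(2))
qed

lemma psi_0 [simp]: "\<psi> 0 = 1"
  using prime_gt_0_nat[OF prime_p] by (simp add: psi_eq_1_iff abs_trace_def power_0_left)

lemma psi_power_q: "\<psi> (x ^ q) = \<psi> x"
  by (simp only: add_char_def abs_trace_power_q)

text \<open>After division by \<open>T v\<close> the absolute trace becomes a nonzero polynomial in
  \<open>r\<close> of degree at most \<open>p ^ (n - 1)\<close>, which is less than
  \<open>q\<close>, so it cannot vanish on the whole small field.\<close>

lemma ex_psi_neq_1:
  assumes "T v \<noteq> 0"
  obtains r where "r \<in> Fq" "\<psi> (r * v) \<noteq> 1"
proof -
  have p: "p > 1"
    using prime_p by (rule prime_gt_1_nat)
  define P :: "'a poly" where "P = (\<Sum>i<n. monom 1 (p ^ i))"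
  have "coeff P (p ^ 0) = (\<Sum>i<n. if i = 0 then 1 else 0)"
    unfolding P_def coeff_sum coeff_monom using p by (intro sum.cong) (auto simp: power_inject_exp)
  then have "coeff P 1 = 1"
    using n_pos by simp
  then have "P \<noteq> 0"
    by auto
  have "degree P \<le> p ^ (n - 1)"
    unfolding P_def
  proof (rule degree_sum_le)
    fix i assume "i \<in> {..<n}"
    then have "p ^ i \<le> p ^ (n - 1)"
      using p by (intro power_increasing) auto
    then show "degree (monom (1 :: 'a) (p ^ i)) \<le> p ^ (n - 1)"
      by (simp add: degree_monom_eq)
  qed simp
  have "p ^ (n - 1) < q"
    unfolding q_def using p n_pos by (intro power_strict_increasing) auto
  have "card {r. poly P r = 0} \<le> degree P"
    using \<open>P \<noteq> 0\<close> by (rule card_poly_roots_bound)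
  then have "card {r. poly P r = 0} < card Fq"
    using \<open>degree P \<le> p ^ (n - 1)\<close> \<open>p ^ (n - 1) < q\<close> by (simp add: card_Fq)
  then have "\<not> Fq \<subseteq> {r. poly P r = 0}"
    by (metis card_mono finite_class.finite not_le)
  then obtain r where r: "r \<in> Fq" "poly P r \<noteq> 0"
    by auto
  \<comment> \<open>The multiplier \<open>r / T v\<close> is chosen so that the relative trace is
    exactly \<open>r\<close>.\<close>
  have "T (r / T v * v) = r / T v * T v"
    using r T_in_Fq by (intro T_mult Fq_divide)
  then have "abs_trace p (2 * n) (r / T v * v) = poly P r"
    using assms by (simp add: abs_trace_eq P_def poly_sum poly_monom)
  then show ?thesis
    using r that[of "r / T v"] by (simp add: psi_eq_1_iff Fq_divide T_in_Fq)
qed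

text \<open>Orthogonality: if some \<open>\<psi> (r0 * v)\<close> differs from 1, translation by
  \<open>r0\<close> multiplies the sum by that value, so the sum is 0.\<close>

lemma sum_psi_Fq: "(\<Sum>r\<in>Fq. \<psi> (r * v)) = (if T v = 0 then of_nat q else 0)"
proof (cases "T v = 0")
  case True
  have "\<psi> (r * v) = 1" if "r \<in> Fq" for r
    using that True prime_gt_0_nat[OF prime_p]
    by (simp add: psi_eq_1_iff abs_trace_eq T_mult power_0_left)
  then show ?thesis
    using True by (simp add: card_Fq)
next
  case False
  then obtain r0 where r0: "r0 \<in> Fq" "\<psi> (r0 * v) \<noteq> 1"
    by (rule ex_psi_neq_1)
  have "(\<Sum>r\<in>Fq. \<psi> (r * v)) = (\<Sum>r\<in>Fq. \<psi> ((r0 + r) * v))"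
    by (rule sum.reindex_bij_witness[of _ "\<lambda>r. r0 + r" "\<lambda>r. r - r0"])
       (use r0 in \<open>auto simp: Fq_add Fq_diff\<close>)
  also have "\<dots> = \<psi> (r0 * v) * (\<Sum>r\<in>Fq. \<psi> (r * v))"
    by (simp add: distrib_right psi_add sum_distrib_left)
  finally show ?thesis
    using r0 False by (simp add: mult_cancel_right1)
qed

lemma sum_psi: "(\<Sum>x\<in>UNIV. \<psi> (x * v)) = (if v = 0 then of_nat (q ^ 2) else 0)"
proof (cases "v = 0")
  case False
  obtain r0 where r0: "r0 \<in> Fq" "\<psi> (r0 * 1) \<noteq> 1"
    using T_1 by (rule ex_psi_neq_1)
  have "(\<Sum>x\<in>UNIV. \<psi> (x * v)) = (\<Sum>x\<in>UNIV. \<psi> ((r0 / v + x) * v))"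
    by (rule sum.reindex_bij_witness[of _ "\<lambda>r. r0 / v + r" "\<lambda>r. r - r0 / v"]) auto
  also have "\<dots> = \<psi> r0 * (\<Sum>x\<in>UNIV. \<psi> (x * v))"
    using False by (simp add: distrib_right psi_add sum_distrib_left)
  finally show ?thesis
    using r0 False by (simp add: mult_cancel_right1)
qed (simp add: card_UNIV)

text \<open>Scaling by nonzero \<open>r\<close> in the small field leaves the sum unchanged because
  such \<open>r\<close> are squares. Averaging over \<open>r\<close> turns \<psi> into the indicator
  of trace 0, and what remains is \<open>q * fibre_sum 0\<close>.\<close>

lemma gauss_sum: "(\<Sum>z\<in>UNIV. of_int (quad_char z) * \<psi> z) = of_int (eps * int q)"
proof -
  define G where "G = (\<Sum>z\<in>UNIV. of_int (quad_char z) * \<psi> z)"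
  have G: "G = (\<Sum>z\<in>UNIV. of_int (quad_char z) * \<psi> (r * z))" if "r \<in> Fq - {0}" for r
    unfolding G_def
    by (rule sum.reindex_bij_witness[of _ "\<lambda>z. r * z" "\<lambda>z. inverse r * z"])
       (use that in \<open>auto simp: quad_char_mult quad_char_Fq Fq_inverse simp flip: mult.assoc\<close>)
  have "of_nat (q - 1) * G = (\<Sum>r\<in>Fq - {0}. G)"
    by (simp add: card_Fq)
  also have "\<dots> = (\<Sum>r\<in>Fq - {0}. \<Sum>z\<in>UNIV. of_int (quad_char z) * \<psi> (r * z))"
    using G by (intro sum.cong) auto
  also have "\<dots> = (\<Sum>z\<in>UNIV. of_int (quad_char z) * (\<Sum>r\<in>Fq - {0}. \<psi> (r * z)))"
    by (subst sum.swap) (simp add: sum_distrib_left)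
  also have "\<dots> = (\<Sum>z\<in>UNIV. (if T z = 0 then of_nat q * of_int (quad_char z) else 0)
      - of_int (quad_char z))"
  proof (rule sum.cong[OF refl])
    fix z
    have "(\<Sum>r\<in>Fq. \<psi> (r * z)) = \<psi> (0 * z) + (\<Sum>r\<in>Fq - {0}. \<psi> (r * z))"
      by (rule sum.remove) auto
    then have "(\<Sum>r\<in>Fq - {0}. \<psi> (r * z)) = (if T z = 0 then of_nat q else 0) - 1"
      by (simp add: sum_psi_Fq)
    then show "of_int (quad_char z) * (\<Sum>r\<in>Fq - {0}. \<psi> (r * z))
        = (if T z = 0 then of_nat q * of_int (quad_char z) else 0) - of_int (quad_char z)"
      by (cases "T z = 0") (simp_all add: right_diff_distrib)
  qed
  also have "\<dots> = of_nat q * of_int (fibre_sum 0) - of_int (\<Sum>z\<in>UNIV. quad_char (z :: 'a))"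
    by (simp add: sum_subtractf fibre_sum_def sum_distrib_left flip: sum.inter_filter)
  also have "\<dots> = of_nat (q - 1) * of_int (eps * int q)"
    using q_pos by (simp add: sum_quad_char fibre_sum_0 of_nat_diff)
  finally show ?thesis
    using q_ge_3 by (simp add: G_def)
qed

lemma gauss_sum_mult:
  "(\<Sum>z\<in>UNIV. of_int (quad_char z) * \<psi> (z * v)) = of_int (eps * int q * quad_char v)"
proof (cases "v = 0")
  case True
  then show ?thesis
    using arg_cong[OF sum_quad_char, of "of_int :: int \<Rightarrow> complex"] by simp
next
  case False
  then have v: "quad_char v * quad_char v = 1"
    using quad_char_cases[of v] by auto
  have "of_int (eps * int q) = (\<Sum>z\<in>UNIV. of_int (quad_char (z * v)) * \<psi> (z * v))"
    unfolding gauss_sum[symmetric]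
    by (rule sum.reindex_bij_witness[of _ "\<lambda>z. z * v" "\<lambda>z. z / v"]) (use False in auto)
  also have "\<dots> = of_int (quad_char v) * (\<Sum>z\<in>UNIV. of_int (quad_char z) * \<psi> (z * v))"
    by (simp add: quad_char_mult sum_distrib_left mult_ac)
  finally have "of_int (quad_char v) * of_int (eps * int q)
      = (of_int (quad_char v * quad_char v) :: complex) * (\<Sum>z\<in>UNIV. of_int (quad_char z) * \<psi> (z * v))"
    by (simp add: mult.assoc)
  then show ?thesis
    by (simp add: v mult.commute)
qed

text \<open>Twice the indicator of \<open>quad_char u = \<sigma>\<close> is 1, minus the indicator
  of \<open>u = 0\<close>, plus \<open>\<sigma> * quad_char u\<close>. The three parts give an
  orthogonality relation, -1 and a Gauss sum.\<close>

lemma sum_psi_quad_char_eq: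
  assumes "\<sigma> = 1 \<or> \<sigma> = - 1"
  shows "(\<Sum>u | quad_char u = \<sigma>. \<psi> (u * v))
    = ((if v = 0 then of_nat (q ^ 2) else 0) - 1 + of_int (\<sigma> * eps * int q * quad_char v)) / 2"
proof -
  have "2 * (\<Sum>u | quad_char u = \<sigma>. \<psi> (u * v)) = (\<Sum>u\<in>UNIV. 2 * (if quad_char u = \<sigma> then \<psi> (u * v) else 0))"
    by (simp add: sum_distrib_left sum_Collect_eq if_distrib cong: if_cong)
  also have "\<dots> = (\<Sum>u\<in>UNIV. \<psi> (u * v) - (if u = 0 then \<psi> (u * v) else 0)
      + of_int \<sigma> * (of_int (quad_char u) * \<psi> (u * v)))"
  proof (rule sum.cong[OF refl])
    fix u :: 'a
    show "2 * (if quad_char u = \<sigma> then \<psi> (u * v) else 0) = \<psi> (u * v) - (if u = 0 then \<psi> (u * v) else 0)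
      + of_int \<sigma> * (of_int (quad_char u) * \<psi> (u * v))"
      using quad_char_cases[of u] assms by auto
  qed
  also have "\<dots> = (if v = 0 then of_nat (q ^ 2) else 0) - 1 + of_int (\<sigma> * eps * int q * quad_char v)"
    by (simp add: sum.distrib sum_subtractf sum_psi gauss_sum_mult flip: sum_distrib_left)
  finally show ?thesis
    by (metis nonzero_mult_div_cancel_left zero_neq_numeral)
qed

end

context quadratic_extension
begin

section \<open>Points with prescribed slopes\<close>

lemma card_quad_char_eq:
  assumes "\<sigma> = 1 \<or> \<sigma> = - 1"
  shows "2 * int (card {u :: 'a. quad_char u = \<sigma>}) = int q ^ 2 - 1"
proof -
  have "2 * int (card {u :: 'a. quad_char u = \<sigma>}) = (\<Sum>u\<in>(UNIV :: 'a set). if quad_char u = \<sigma> then 2 else 0)"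
    by (simp flip: sum_Collect_eq)
  also have "\<dots> = (\<Sum>u\<in>(UNIV :: 'a set). 1 - (if u = 0 then 1 else 0) + \<sigma> * quad_char u)"
    by (rule sum.cong) (use assms quad_char_cases in \<open>fastforce+\<close>)
  also have "\<dots> = int q ^ 2 - 1"
    by (simp add: sum.distrib sum_subtractf card_UNIV sum_quad_char flip: sum_distrib_left)
  finally show ?thesis .
qed

text \<open>The element \<open>z\<close> is called the slope of the point: it names the spread
  component through it. \<open>Z1\<close> holds the slopes over square \<open>u\<close>,
  \<open>Z2\<close> those over nonsquare \<open>u\<close>.\<close>

definition curve_set :: "'a set \<Rightarrow> 'a set \<Rightarrow> ('a \<times> 'a) set" where
  "curve_set Z1 Z2 = {(u, z * u ^ q) | u z. u \<noteq> 0 \<and> z \<in> (if quad_char u = 1 then Z1 else Z2)}"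

lemma curve_set_eq_image:
  "curve_set Z1 Z2 = (\<lambda>(u, z). (u, z * u ^ q)) `
     ({u. quad_char u = 1} \<times> Z1 \<union> {u. quad_char u = - 1} \<times> Z2)"
proof -
  have "{(u :: 'a, z). u \<noteq> 0 \<and> z \<in> (if quad_char u = 1 then Z1 else Z2)}
      = {u. quad_char u = 1} \<times> Z1 \<union> {u. quad_char u = - 1} \<times> Z2"
    by (auto dest: quad_char_cases split: if_splits)
  moreover have "curve_set Z1 Z2
      = (\<lambda>(u, z). (u, z * u ^ q)) ` {(u, z). u \<noteq> 0 \<and> z \<in> (if quad_char u = 1 then Z1 else Z2)}"
  proof
    show "curve_set Z1 Z2
        \<subseteq> (\<lambda>(u, z). (u, z * u ^ q)) ` {(u, z). u \<noteq> 0 \<and> z \<in> (if quad_char u = 1 then Z1 else Z2)}"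
    proof
      fix x assume "x \<in> curve_set Z1 Z2"
      then obtain u z where "x = (u, z * u ^ q)" "u \<noteq> 0" "z \<in> (if quad_char u = 1 then Z1 else Z2)"
        by (auto simp: curve_set_def)
      then show "x \<in> (\<lambda>(u, z). (u, z * u ^ q)) `
          {(u, z). u \<noteq> 0 \<and> z \<in> (if quad_char u = 1 then Z1 else Z2)}"
        by (intro image_eqI[of _ _ "(u, z)"]) auto
    qed
    show "(\<lambda>(u, z). (u, z * u ^ q)) ` {(u, z). u \<noteq> 0 \<and> z \<in> (if quad_char u = 1 then Z1 else Z2)}
        \<subseteq> curve_set Z1 Z2"
      unfolding curve_set_def by (rule image_subsetI) (simp only: mem_Collect_eq split_beta, blast)
  qed
  ultimately show ?thesis
    by (simp only:)
qed

lemma inj_on_curve: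
  "inj_on (\<lambda>(u, z). (u, z * u ^ q :: 'a))
     ({u. quad_char u = 1} \<times> Z1 \<union> {u. quad_char u = - 1} \<times> Z2)"
  by (rule inj_onI) auto

lemma mem_curve_set:
  "(u, v) \<in> curve_set Z1 Z2 \<longleftrightarrow> u \<noteq> 0 \<and> v / u ^ q \<in> (if quad_char u = 1 then Z1 else Z2)"
  by (auto simp: curve_set_def intro!: exI[of _ "v / u ^ q"])

lemma card_curve_set:
  assumes "Z1 \<inter> Z2 = {}"
  shows "2 * int (card (curve_set Z1 Z2)) = (int q ^ 2 - 1) * int (card (Z1 \<union> Z2))"
proof -
  have "card (curve_set Z1 Z2)
      = card ({u :: 'a. quad_char u = 1} \<times> Z1 \<union> {u :: 'a. quad_char u = - 1} \<times> Z2)"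
    unfolding curve_set_eq_image by (rule card_image) (rule inj_on_curve)
  also have "\<dots> = card {u :: 'a. quad_char u = 1} * card Z1 + card {u :: 'a. quad_char u = - 1} * card Z2"
    by (subst card_Un_disjoint) (auto simp: card_cartesian_product)
  finally have "2 * int (card (curve_set Z1 Z2))
      = (2 * int (card {u :: 'a. quad_char u = 1})) * int (card Z1)
      + (2 * int (card {u :: 'a. quad_char u = - 1})) * int (card Z2)"
    by simp
  also have "\<dots> = (int q ^ 2 - 1) * int (card (Z1 \<union> Z2))"
    using assms by (simp add: card_quad_char_eq card_Un_disjoint algebra_simps)
  finally show ?thesis .
qed

lemma curve_set_scale:
  assumes "t \<in> Fq - {0}" "(u, v) \<in> curve_set Z1 Z2"
  shows "(t * u, t * v) \<in> curve_set Z1 Z2"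
  using assms by (auto simp: mem_curve_set quad_char_mult quad_char_Fq power_mult_distrib mem_Fq)

end

context quadratic_extension_char
begin

text \<open>For a fixed slope the argument of \<psi> can be made linear in \<open>u\<close>, so the
  sum over \<open>u\<close> of fixed character is known; the factor 2 clears its denominator. The
  two character classes enter with opposite signs.\<close>

lemma char_sum_curve_set:
  assumes "Z1 \<inter> Z2 = {}"
  shows "2 * char_sum \<zeta> p (2 * n) a b (curve_set Z1 Z2) =
    of_int (int q ^ 2 * int (card {z \<in> Z1 \<union> Z2. a + (b * z) ^ q = 0}) - int (card (Z1 \<union> Z2))
      + eps * int q * ((\<Sum>z\<in>Z1. quad_char (a + (b * z) ^ q)) - (\<Sum>z\<in>Z2. quad_char (a + (b * z) ^ q))))"
proof -
  define v where "v z = a + (b * z) ^ q" for z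
  have psi: "\<psi> (a * u + b * (z * u ^ q)) = \<psi> (u * v z)" for u z
  proof -
    \<comment> \<open>Only this summand is raised to the power \<open>q\<close>, which turns
      \<open>u ^ q\<close> back into \<open>u\<close>.\<close>
    have "\<psi> (b * (z * u ^ q)) = \<psi> ((b * (z * u ^ q)) ^ q)"
      by (rule psi_power_q[symmetric])
    also have "(b * (z * u ^ q)) ^ q = u * (b * z) ^ q"
      by (simp add: power_mult_distrib power_q_q mult_ac)
    finally show ?thesis
      by (simp only: v_def psi_add distrib_left mult.commute[of a])
  qed
  define S where "S \<sigma> Z = (\<Sum>z\<in>Z. \<Sum>u | quad_char u = \<sigma>. \<psi> (u * v z))" for \<sigma> Z
  have S: "2 * S \<sigma> Z = of_int (int q ^ 2 * int (card {z \<in> Z. v z = 0}) - int (card Z)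
      + \<sigma> * eps * int q * (\<Sum>z\<in>Z. quad_char (v z)))" if "\<sigma> = 1 \<or> \<sigma> = - 1" for \<sigma> Z
  proof -
    have "2 * S \<sigma> Z = (\<Sum>z\<in>Z. (if v z = 0 then of_nat (q ^ 2) else 0) - 1
        + of_int (\<sigma> * eps * int q) * of_int (quad_char (v z)))"
      unfolding S_def sum_psi_quad_char_eq[OF that] sum_distrib_left
      by (rule sum.cong) simp_all
    also have "\<dots> = (\<Sum>z\<in>Z. (if v z = 0 then of_nat (q ^ 2) else 0)) - of_nat (card Z)
        + of_int (\<sigma> * eps * int q) * (\<Sum>z\<in>Z. of_int (quad_char (v z)))"
      by (simp only: sum.distrib sum_subtractf sum_distrib_left sum_constant mult_1_right)
    also have "(\<Sum>z\<in>Z. (if v z = 0 then of_nat (q ^ 2) else 0 :: complex))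
        = of_nat (q ^ 2) * of_nat (card {z \<in> Z. v z = 0})"
      by (simp flip: sum.inter_filter)
    finally show ?thesis
      by simp
  qed
  have "char_sum \<zeta> p (2 * n) a b (curve_set Z1 Z2)
      = (\<Sum>(u, z)\<in>{u. quad_char u = 1} \<times> Z1 \<union> {u. quad_char u = - 1} \<times> Z2. \<psi> (u * v z))"
    unfolding char_sum_def curve_set_eq_image
    by (subst sum.reindex[OF inj_on_curve]) (simp add: case_prod_unfold psi)
  also have "\<dots> = (\<Sum>(u, z)\<in>{u. quad_char u = 1} \<times> Z1. \<psi> (u * v z))
      + (\<Sum>(u, z)\<in>{u. quad_char u = - 1} \<times> Z2. \<psi> (u * v z))"
    by (rule sum.union_disjoint) auto
  also have "\<dots> = S 1 Z1 + S (- 1) Z2"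
    unfolding S_def by (simp add: sum.swap[of _ Z1] sum.swap[of _ Z2] flip: sum.cartesian_product)
  finally have eq: "2 * char_sum \<zeta> p (2 * n) a b (curve_set Z1 Z2) = 2 * S 1 Z1 + 2 * S (- 1) Z2"
    by simp
  have "{z \<in> Z1 \<union> Z2. v z = 0} = {z \<in> Z1. v z = 0} \<union> {z \<in> Z2. v z = 0}"
    by auto
  then have "card {z \<in> Z1 \<union> Z2. v z = 0} = card {z \<in> Z1. v z = 0} + card {z \<in> Z2. v z = 0}"
    using assms by (simp add: card_Un_disjoint disjoint_iff)
  moreover have "card (Z1 \<union> Z2) = card Z1 + card Z2"
    using assms by (simp add: card_Un_disjoint)
  ultimately show ?thesis
    unfolding eq by (simp add: S v_def algebra_simps)
qed

lemma char_sum_curve_set_0: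
  assumes "Z1 \<inter> Z2 = {}" "a \<noteq> 0"
  shows "2 * char_sum \<zeta> p (2 * n) a 0 (curve_set Z1 Z2) =
    of_int (eps * int q * quad_char a * (int (card Z1) - int (card Z2)) - int (card (Z1 \<union> Z2)))"
  unfolding char_sum_curve_set[OF assms(1)] using assms(2) q_pos
  by (simp add: zero_power algebra_simps)

text \<open>The slope \<open>w\<close> is the zero of \<open>a + (b * z) ^ q\<close>, which
  therefore equals \<open>(b * (z - w)) ^ q\<close>; the outer power does not change the quadratic
  character.\<close>

lemma char_sum_curve_set_nonzero:
  fixes a b :: 'a
  assumes "Z1 \<inter> Z2 = {}" "b \<noteq> 0"
  defines "w \<equiv> - (a ^ q) / b"
  shows "2 * char_sum \<zeta> p (2 * n) a b (curve_set Z1 Z2) =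
    of_int ((if w \<in> Z1 \<union> Z2 then int q ^ 2 else 0) - int (card (Z1 \<union> Z2))
      + eps * int q * quad_char b * ((\<Sum>z\<in>Z1. quad_char (z - w)) - (\<Sum>z\<in>Z2. quad_char (z - w))))"
proof -
  have v: "a + (b * z) ^ q = (b * (z - w)) ^ q" for z
  proof -
    have "b * (z - w) = b * z + a ^ q"
      using assms(2) by (simp add: w_def distrib_left)
    then show ?thesis
      by (simp add: power_add_q power_q_q)
  qed
  have "{z \<in> Z1 \<union> Z2. a + (b * z) ^ q = 0} = (if w \<in> Z1 \<union> Z2 then {w} else {})"
    unfolding v using assms(2) q_pos by auto
  then have "int (card {z \<in> Z1 \<union> Z2. a + (b * z) ^ q = 0}) = (if w \<in> Z1 \<union> Z2 then 1 else 0)"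
    by simp
  then show ?thesis
    unfolding char_sum_curve_set[OF assms(1)]
    by (simp add: v quad_char_power_q quad_char_mult flip: sum_distrib_left)
       (simp add: algebra_simps)
qed

end

section \<open>The pair of traces of \<open>z\<close> and \<open>\<delta> * z\<close> for a
  nonsquare \<delta>\<close>

locale trace_pair = quadratic_extension_char +
  fixes \<delta> :: 'a
  assumes quad_char_delta: "quad_char \<delta> = - 1"
begin

lemma delta_neq_0 [simp]: "\<delta> \<noteq> 0"
  using quad_char_delta by auto

text \<open>Otherwise both \<open>z\<close> and \<open>\<delta> * z\<close> change sign under the
  \<open>q\<close>-th power, so \<delta> lies in the small field and is a square.\<close>

lemma trace_pair_eq_0D:
  assumes "T z = 0" "T (\<delta> * z) = 0"
  shows "z = 0"
proof (rule ccontr)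
  assume "z \<noteq> 0"
  moreover have "z ^ q = - z"
    using assms(1) by (simp add: rel_trace_def add_eq_0_iff)
  moreover have "(\<delta> * z) ^ q = - (\<delta> * z)"
    using assms(2) by (simp add: rel_trace_def add_eq_0_iff)
  ultimately have "\<delta> ^ q = \<delta>"
    by (simp add: power_mult_distrib)
  then have "quad_char \<delta> = 1"
    by (simp add: quad_char_Fq mem_Fq)
  then show False
    by (simp add: quad_char_delta)
qed

text \<open>The map is additive with trivial kernel, and both sides have \<open>q ^ 2\<close>
  elements. Hence the two traces vary independently.\<close>

lemma bij_betw_trace_pair: "bij_betw (\<lambda>z. (T z, T (\<delta> * z))) UNIV (Fq \<times> Fq)"
proof -
  have inj: "inj (\<lambda>z. (T z, T (\<delta> * z)))"
  proof (rule injI)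
    fix y z assume "(T y, T (\<delta> * y)) = (T z, T (\<delta> * z))"
    then have "T (y - z) = 0" "T (\<delta> * (y - z)) = 0"
      by (simp_all add: T_diff right_diff_distrib)
    then have "y - z = 0"
      by (rule trace_pair_eq_0D)
    then show "y = z"
      by simp
  qed
  have "range (\<lambda>z. (T z, T (\<delta> * z))) = Fq \<times> Fq"
  proof (rule card_seteq)
    show "card (Fq \<times> Fq) \<le> card (range (\<lambda>z. (T z, T (\<delta> * z))))"
      using inj by (simp add: card_image card_cartesian_product card_Fq card_UNIV power2_eq_square)
  qed (auto simp: T_in_Fq)
  then show ?thesis
    using inj by (simp add: bij_betw_def)
qed

lemma sum_trace_pair:
  fixes f g :: "'a \<Rightarrow> int"
  shows "(\<Sum>z\<in>UNIV. f (T z) * g (T (\<delta> * z))) = (\<Sum>s\<in>Fq. f s) * (\<Sum>t\<in>Fq. g t)"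
proof -
  have "(\<Sum>z\<in>UNIV. f (T z) * g (T (\<delta> * z))) = (\<Sum>(s, t)\<in>Fq \<times> Fq. f s * g t)"
    using sum.reindex_bij_betw[OF bij_betw_trace_pair, of "\<lambda>(s, t). f s * g t"] by simp
  then show ?thesis
    by (simp add: sum_product sum.cartesian_product)
qed

text \<open>Substituting \<open>z / \<delta>\<close> reduces the second part to a sum over fibres of
  the trace; the character of \<delta> gives it the opposite sign.\<close>

lemma sum_trace_pair_quad_char:
  fixes f g :: "'a \<Rightarrow> int"
  shows "(\<Sum>z\<in>UNIV. (f (T z) + g (T (\<delta> * z))) * quad_char (z - w))
    = eps * (int q * (f (T w) - g (T (\<delta> * w))) - (\<Sum>s\<in>Fq. f s) + (\<Sum>t\<in>Fq. g t))"
proof -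
  have "(\<Sum>z\<in>UNIV. g (T (\<delta> * z)) * quad_char (z - w))
      = (\<Sum>z\<in>UNIV. g (T z) * (- quad_char (z - \<delta> * w)))"
    by (rule sum.reindex_bij_witness[of _ "\<lambda>z. z / \<delta>" "\<lambda>z. \<delta> * z"])
       (auto simp: quad_char_mult quad_char_delta simp flip: right_diff_distrib)
  also have "\<dots> = - eps * (int q * g (T (\<delta> * w)) - (\<Sum>t\<in>Fq. g t))"
    by (simp add: sum_negf sum_trace_quad_char)
  finally show ?thesis
    by (simp add: distrib_right sum.distrib sum_trace_quad_char) (simp add: algebra_simps)
qed

definition "\<eta>\<^sub>1 z = \<eta> (T z)"
definition "\<eta>\<^sub>2 z = \<eta> (T (\<delta> * z))"

text \<open>
  The index sets \<open>A\<close> and \<open>A'\<close> consist of the \<open>i\<close> with \<open>\<omega> powi i\<close> in \<open>Z\<^sub>A\<close> and \<open>Z\<^sub>A'\<close>.  For \<open>B\<close> and \<open>B'\<close> both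
  signs are reversed in \<open>Z\<^sub>B\<close> and \<open>Z\<^sub>B'\<close>, since \<open>y ^ (q + 1)\<close> is a nonsquare of the small field for
  nonsquare \<open>y\<close>.  The slope \<open>0\<close> in \<open>Z\<^sub>A'\<close> accounts for the points \<open>(y, 0)\<close> of \<open>C\<^sub>1\<close>.
\<close>

definition "Z\<^sub>A = {z. \<eta>\<^sub>1 z \<ge> 0 \<and> \<eta>\<^sub>2 z = 1}"
definition "Z\<^sub>B = {z. \<eta>\<^sub>1 z = - 1 \<and> \<eta>\<^sub>2 z \<le> 0}"
definition "Z\<^sub>A' = {z. \<eta>\<^sub>1 z \<ge> 0 \<and> \<eta>\<^sub>2 z \<le> 0}"
definition "Z\<^sub>B' = {z. \<eta>\<^sub>1 z = - 1 \<and> \<eta>\<^sub>2 z = 1}"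

definition zero_ind :: "'a \<Rightarrow> int" where
  "zero_ind s = (if s = 0 then 1 else 0)"

lemma sum_zero_ind: "(\<Sum>s\<in>Fq. zero_ind s) = 1"
  by (simp add: zero_ind_def)

lemma eta_values:
  obtains "\<eta> s = 1" "zero_ind s = 0" | "\<eta> s = 0" "zero_ind s = 1" | "\<eta> s = - 1" "zero_ind s = 0"
  using quad_char_q_cases[of s q] by (cases "s = 0") (auto simp: zero_ind_def)

lemma Z_disjoint: "Z\<^sub>A \<inter> Z\<^sub>B = {}" "Z\<^sub>A' \<inter> Z\<^sub>B' = {}"
  by (auto simp: Z\<^sub>A_def Z\<^sub>B_def Z\<^sub>A'_def Z\<^sub>B'_def)

text \<open>The nine sign patterns of the two traces are divided among \<open>Z\<^sub>A\<close>,
  \<open>Z\<^sub>B\<close>, \<open>Z\<^sub>A'\<close>, \<open>Z\<^sub>B'\<close> as 2 + 2 + 4 +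
  1.\<close>

lemma Z_compl: "Z\<^sub>A' \<union> Z\<^sub>B' = - (Z\<^sub>A \<union> Z\<^sub>B)"
proof -
  have "z \<in> Z\<^sub>A' \<union> Z\<^sub>B' \<longleftrightarrow> z \<notin> Z\<^sub>A \<union> Z\<^sub>B" for z
    by (rule eta_values[of "T z"]; rule eta_values[of "T (\<delta> * z)"])
       (auto simp: Z\<^sub>A_def Z\<^sub>B_def Z\<^sub>A'_def Z\<^sub>B'_def \<eta>\<^sub>1_def \<eta>\<^sub>2_def)
  then show ?thesis
    by blast
qed

text \<open>The right side adds two signs: that of \<open>T z\<close> with 0 counted as positive,
  and that of \<open>T (\<delta> * z)\<close> with 0 counted as negative. They are both 1 on
  \<open>Z\<^sub>A\<close>, both -1 on \<open>Z\<^sub>B\<close>, and cancel elsewhere.\<close>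

lemma ind_Z:
  "2 * (of_bool (z \<in> Z\<^sub>A) - of_bool (z \<in> Z\<^sub>B))
     = (\<eta> (T z) + zero_ind (T z)) + (\<eta> (T (\<delta> * z)) - zero_ind (T (\<delta> * z)))"
  by (rule eta_values[of "T z"]; rule eta_values[of "T (\<delta> * z)"])
     (simp_all add: Z\<^sub>A_def Z\<^sub>B_def \<eta>\<^sub>1_def \<eta>\<^sub>2_def)

text \<open>Same as before with the second sign reversed.\<close>

lemma ind_Z':
  "2 * (of_bool (z \<in> Z\<^sub>A') - of_bool (z \<in> Z\<^sub>B'))
     = (\<eta> (T z) + zero_ind (T z)) + (zero_ind (T (\<delta> * z)) - \<eta> (T (\<delta> * z)))"
  by (rule eta_values[of "T z"]; rule eta_values[of "T (\<delta> * z)"])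
     (simp_all add: Z\<^sub>A'_def Z\<^sub>B'_def \<eta>\<^sub>1_def \<eta>\<^sub>2_def)

text \<open>The two sign functions sum to 1 and -1 over the small field, which gives the constant
  -2; in the primed version both sum to 1 and the constant cancels.\<close>

lemma sum_diff_Z:
  "2 * ((\<Sum>z\<in>Z\<^sub>A. quad_char (z - w)) - (\<Sum>z\<in>Z\<^sub>B. quad_char (z - w)))
    = eps * (int q * (\<eta> (T w) + zero_ind (T w) - \<eta> (T (\<delta> * w)) + zero_ind (T (\<delta> * w))) - 2)"
  unfolding sum_diff_eq[OF Z_disjoint(1)] sum_distrib_left mult.assoc[symmetric] ind_Z
  by (subst sum_trace_pair_quad_char[of "\<lambda>s. \<eta> s + zero_ind s" "\<lambda>s. \<eta> s - zero_ind s"])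
     (simp add: sum.distrib sum_subtractf sum_eta sum_zero_ind algebra_simps)

lemma sum_diff_Z':
  "2 * ((\<Sum>z\<in>Z\<^sub>A'. quad_char (z - w)) - (\<Sum>z\<in>Z\<^sub>B'. quad_char (z - w)))
    = eps * (int q * (\<eta> (T w) + zero_ind (T w) + \<eta> (T (\<delta> * w)) - zero_ind (T (\<delta> * w))))"
  unfolding sum_diff_eq[OF Z_disjoint(2)] sum_distrib_left mult.assoc[symmetric] ind_Z'
  by (subst sum_trace_pair_quad_char[of "\<lambda>s. \<eta> s + zero_ind s" "\<lambda>s. zero_ind s - \<eta> s"])
     (simp add: sum.distrib sum_subtractf sum_eta sum_zero_ind algebra_simps)

lemma sum_trace_pair_1:
  fixes f :: "'a \<Rightarrow> int"
  shows "(\<Sum>z\<in>UNIV. f (T z)) = int q * (\<Sum>s\<in>Fq. f s)"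
    and "(\<Sum>z\<in>UNIV. f (T (\<delta> * z))) = int q * (\<Sum>s\<in>Fq. f s)"
  using sum_trace_pair[of f "\<lambda>_. 1"] sum_trace_pair[of "\<lambda>_. 1" f] by (simp_all add: card_Fq)

lemma card_diff_Z: "int (card Z\<^sub>A) - int (card Z\<^sub>B) = 0"
proof -
  have "2 * (\<Sum>z\<in>UNIV. of_bool (z \<in> Z\<^sub>A) - of_bool (z \<in> Z\<^sub>B)) = (0 :: int)"
    unfolding sum_distrib_left ind_Z
    by (simp add: sum.distrib sum_subtractf sum_trace_pair_1 sum_eta sum_zero_ind)
  then show ?thesis
    unfolding card_eq_sum sum_subtractf by simp
qed

lemma card_diff_Z': "int (card Z\<^sub>A') - int (card Z\<^sub>B') = int q"
proof -
  have "2 * (\<Sum>z\<in>UNIV. of_bool (z \<in> Z\<^sub>A') - of_bool (z \<in> Z\<^sub>B')) = 2 * int q"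
    unfolding sum_distrib_left ind_Z'
    by (simp add: sum.distrib sum_subtractf sum_trace_pair_1 sum_eta sum_zero_ind)
  then show ?thesis
    unfolding card_eq_sum sum_subtractf by simp
qed

text \<open>A slope belongs to the union exactly when its two signs agree, so twice the indicator is
  1 plus their product. After expansion only the constant and the product of the two
  \<open>zero_ind\<close> factors have a nonzero sum.\<close>

lemma card_Z: "2 * int (card (Z\<^sub>A \<union> Z\<^sub>B)) = int q ^ 2 - 1"
proof -
  have "2 * int (card (Z\<^sub>A \<union> Z\<^sub>B)) = (\<Sum>z\<in>UNIV. 2 * of_bool (z \<in> Z\<^sub>A \<union> Z\<^sub>B))"
    unfolding card_eq_sum sum_distrib_left ..
  also have "\<dots> = (\<Sum>z\<in>UNIV. 1 + \<eta> (T z) * \<eta> (T (\<delta> * z)) + zero_ind (T z) * \<eta> (T (\<delta> * z))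
      - \<eta> (T z) * zero_ind (T (\<delta> * z)) - zero_ind (T z) * zero_ind (T (\<delta> * z)))"
  proof (rule sum.cong[OF refl])
    fix z
    show "2 * of_bool (z \<in> Z\<^sub>A \<union> Z\<^sub>B) = 1 + \<eta> (T z) * \<eta> (T (\<delta> * z)) + zero_ind (T z) * \<eta> (T (\<delta> * z))
      - \<eta> (T z) * zero_ind (T (\<delta> * z)) - zero_ind (T z) * zero_ind (T (\<delta> * z))"
      by (rule eta_values[of "T z"]; rule eta_values[of "T (\<delta> * z)"])
         (simp_all add: Z\<^sub>A_def Z\<^sub>B_def \<eta>\<^sub>1_def \<eta>\<^sub>2_def)
  qed
  also have "\<dots> = int q ^ 2 - 1"
    by (simp add: sum.distrib sum_subtractf sum_trace_pair sum_eta sum_zero_ind card_UNIV)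
  finally show ?thesis .
qed

lemma card_Z': "2 * int (card (Z\<^sub>A' \<union> Z\<^sub>B')) = int q ^ 2 + 1"
proof -
  have "int (card (- Z)) = int q ^ 2 - int (card Z)" for Z :: "'a set"
    using card_mono[of UNIV Z]
    by (simp add: Compl_eq_Diff_UNIV card_Diff_subset card_UNIV of_nat_diff)
  from this[of "Z\<^sub>A \<union> Z\<^sub>B"] show ?thesis
    unfolding Z_compl using card_Z by linarith
qed

text \<open>
  This is \<open>C\<^sub>0\<close>, and \<open>C\<^sub>1\<close> is \<open>curve_set Z\<^sub>A' Z\<^sub>B'\<close>; \<open>C\<^sub>2\<close> and \<open>C\<^sub>3\<close> are their images under \<open>twist\<close> below.
\<close>

definition base_C :: "('a \<times> 'a) set" where
  "base_C = {0} \<times> {y. quad_char y = eps} \<union> curve_set Z\<^sub>A Z\<^sub>B"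

section \<open>Sizes and character values of the first two sets\<close>

lemma eps_cases: "eps = 1 \<or> eps = - 1"
  by (simp add: eps_def) (metis neg_one_even_power neg_one_odd_power)

lemma base_C_disjoint: "({0} \<times> {y. quad_char y = eps}) \<inter> curve_set Z\<^sub>A Z\<^sub>B = {}"
  by (auto simp: mem_curve_set)

text \<open>Multiplying by 4 moves everything to integers; the last two assumptions say that no
  other value occurs and that both values occur.\<close>

lemma type_Q_I:
  assumes "E \<subseteq> UNIV - {(0, 0)}"
    and "\<And>t u v. t \<in> Fq - {0} \<Longrightarrow> (u, v) \<in> E \<Longrightarrow> (t * u, t * v) \<in> E"
    and "4 * int (card E) = int q ^ 4 - 1"
    and "\<And>a b. (a, b) \<noteq> (0, 0) \<Longrightarrow> \<exists>k \<in> {int q ^ 2 - 1, - 3 * int q ^ 2 - 1}.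
      4 * char_sum \<zeta> p (2 * n) a b E = of_int k"
    and "\<And>k. k \<in> {int q ^ 2 - 1, - 3 * int q ^ 2 - 1} \<Longrightarrow>
      \<exists>a b. (a, b) \<noteq> (0, 0) \<and> 4 * char_sum \<zeta> p (2 * n) a b E = of_int k"
  shows "type_Q \<zeta> p n E"
  unfolding type_Q_def
proof (intro conjI)
  show "E \<subseteq> UNIV - {(0, 0)}"
    by fact
  show "\<forall>t\<in>subfield_q (p ^ n) - {0}. \<forall>(x, y)\<in>E. (t * x, t * y) \<in> E"
    using assms(2) by (auto simp flip: q_def)
  have "real_of_int (4 * int (card E)) = real_of_int (int q ^ 4 - 1)"
    by (simp only: assms(3))
  then show "real (card E) = (real (p ^ n) ^ 4 - 1) / 4"
    by (simp flip: q_def)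
  have div: "x = of_int k / 4 \<longleftrightarrow> 4 * x = of_int k" for x :: complex and k
    by (simp add: field_simps)
  have "{char_sum \<zeta> p (2 * n) a b E | a b. (a, b) \<noteq> (0, 0)}
      = {of_int (int q ^ 2 - 1) / 4, of_int (- 3 * int q ^ 2 - 1) / 4}"
    (is "?L = ?R")
  proof
    show "?L \<subseteq> ?R"
    proof
      fix x assume "x \<in> ?L"
      then obtain a b where "x = char_sum \<zeta> p (2 * n) a b E" "(a, b) \<noteq> (0, 0)"
        by auto
      with assms(4)[of a b] show "x \<in> ?R"
        by (auto simp only: div insert_iff)
    qed
    show "?R \<subseteq> ?L"
    proof
      fix x assume "x \<in> ?R"
      then have "4 * x = of_int (int q ^ 2 - 1) \<or> 4 * x = of_int (- 3 * int q ^ 2 - 1)"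
        by (simp only: div insert_iff empty_iff simp_thms)
      then obtain k where k: "k \<in> {int q ^ 2 - 1, - 3 * int q ^ 2 - 1}" "4 * x = of_int k"
        by blast
      obtain a b where ab: "(a, b) \<noteq> (0, 0)" "4 * char_sum \<zeta> p (2 * n) a b E = of_int k"
        using assms(5)[OF k(1)] by auto
      have "4 * x = 4 * char_sum \<zeta> p (2 * n) a b E"
        using ab(2) k(2) by (simp only:)
      then have "x = char_sum \<zeta> p (2 * n) a b E"
        by simp
      then show "x \<in> ?L"
        using ab(1) by blast
    qed
  qed
  then show "{char_sum \<zeta> p (2 * n) a b E | a b. (a, b) \<noteq> (0, 0)}
      = {(of_nat (p ^ n) ^ 2 - 1) / 4, (- 3 * of_nat (p ^ n) ^ 2 - 1) / 4}"
    by (simp flip: q_def)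
qed

lemma char_sum_base_C:
  "char_sum \<zeta> p (2 * n) a b base_C
    = (\<Sum>y | quad_char y = eps. \<psi> (y * b)) + char_sum \<zeta> p (2 * n) a b (curve_set Z\<^sub>A Z\<^sub>B)"
proof -
  have "(\<Sum>(x, y)\<in>{0} \<times> {y. quad_char y = eps}. \<psi> (a * x + b * y)) = (\<Sum>y | quad_char y = eps. \<psi> (y * b))"
    by (simp add: mult.commute flip: sum.cartesian_product)
  then show ?thesis
    unfolding base_C_def char_sum_def by (subst sum.union_disjoint) (use base_C_disjoint in auto)
qed

text \<open>The axis carries the class \<open>eps\<close>, so this sign cancels against the sign of
  the Gauss sum.\<close>

lemma four_char_sum_base_C:
  "4 * char_sum \<zeta> p (2 * n) a b base_C
    = of_int (2 * ((if b = 0 then int q ^ 2 else 0) - 1 + int q * quad_char b))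
      + 2 * (2 * char_sum \<zeta> p (2 * n) a b (curve_set Z\<^sub>A Z\<^sub>B))"
proof -
  have "eps * eps * int q * quad_char b = int q * quad_char b"
    by simp
  then have S: "(\<Sum>y | quad_char y = eps. \<psi> (y * b))
      = of_int ((if b = 0 then int q ^ 2 else 0) - 1 + int q * quad_char b) / 2"
    unfolding sum_psi_quad_char_eq[OF eps_cases] by simp
  show ?thesis
    unfolding char_sum_base_C S distrib_left of_int_mult[of 2] by simp
qed

text \<open>The axis contributes \<open>2 * q * quad_char b\<close>, which cancels the constant -2
  of \<open>sum_diff_Z\<close>. Apart from -1, only multiples of \<open>q ^ 2\<close>
  remain.\<close>

lemma four_char_sum_base_C_nonzero:
  fixes a b :: 'a
  assumes "b \<noteq> 0"
  defines "w \<equiv> - (a ^ q) / b"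
  shows "4 * char_sum \<zeta> p (2 * n) a b base_C
    = of_int ((if w \<in> Z\<^sub>A \<union> Z\<^sub>B then 2 * int q ^ 2 else 0) - int q ^ 2 - 1
       + int q ^ 2 * quad_char b *
         (\<eta> (T w) + zero_ind (T w) - \<eta> (T (\<delta> * w)) + zero_ind (T (\<delta> * w))))"
proof -
  define D where "D = (\<Sum>z\<in>Z\<^sub>A. quad_char (z - w)) - (\<Sum>z\<in>Z\<^sub>B. quad_char (z - w))"
  define m where "m = \<eta> (T w) + zero_ind (T w) - \<eta> (T (\<delta> * w)) + zero_ind (T (\<delta> * w))"
  have "eps * (2 * D) = eps * eps * (int q * m - 2)"
    unfolding D_def m_def sum_diff_Z by simp
  then have D: "eps * (2 * D) = int q * m - 2"
    by simp
  have "4 * char_sum \<zeta> p (2 * n) a b base_C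
      = of_int (2 * (int q * quad_char b - 1)
        + 2 * ((if w \<in> Z\<^sub>A \<union> Z\<^sub>B then int q ^ 2 else 0) - int (card (Z\<^sub>A \<union> Z\<^sub>B)) + eps * int q * quad_char b * D))"
    unfolding four_char_sum_base_C char_sum_curve_set_nonzero[OF Z_disjoint(1) assms(1)] D_def w_def
    using assms(1) by simp
  also have "2 * (int q * quad_char b - 1)
        + 2 * ((if w \<in> Z\<^sub>A \<union> Z\<^sub>B then int q ^ 2 else 0) - int (card (Z\<^sub>A \<union> Z\<^sub>B)) + eps * int q * quad_char b * D)
      = 2 * (int q * quad_char b - 1) + (if w \<in> Z\<^sub>A \<union> Z\<^sub>B then 2 * int q ^ 2 else 0)
        - 2 * int (card (Z\<^sub>A \<union> Z\<^sub>B)) + int q * quad_char b * (eps * (2 * D))"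
    by (simp add: algebra_simps)
  also have "\<dots> = (if w \<in> Z\<^sub>A \<union> Z\<^sub>B then 2 * int q ^ 2 else 0) - int q ^ 2 - 1 + int q ^ 2 * quad_char b * m"
    unfolding D card_Z by (simp add: algebra_simps power2_eq_square)
  finally show ?thesis
    by (simp only: m_def)
qed

lemma four_char_sum_curve_set':
  fixes a b :: 'a
  assumes "b \<noteq> 0"
  defines "w \<equiv> - (a ^ q) / b"
  shows "4 * char_sum \<zeta> p (2 * n) a b (curve_set Z\<^sub>A' Z\<^sub>B')
    = of_int ((if w \<in> Z\<^sub>A' \<union> Z\<^sub>B' then 2 * int q ^ 2 else 0) - int q ^ 2 - 1
       + int q ^ 2 * quad_char b *
         (\<eta> (T w) + zero_ind (T w) + \<eta> (T (\<delta> * w)) - zero_ind (T (\<delta> * w))))"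
proof -
  define D where "D = (\<Sum>z\<in>Z\<^sub>A'. quad_char (z - w)) - (\<Sum>z\<in>Z\<^sub>B'. quad_char (z - w))"
  define m where "m = \<eta> (T w) + zero_ind (T w) + \<eta> (T (\<delta> * w)) - zero_ind (T (\<delta> * w))"
  have "eps * (2 * D) = eps * eps * (int q * m)"
    unfolding D_def m_def sum_diff_Z' by simp
  then have D: "eps * (2 * D) = int q * m"
    by simp
  have "4 * char_sum \<zeta> p (2 * n) a b (curve_set Z\<^sub>A' Z\<^sub>B') = 2 * (2 * char_sum \<zeta> p (2 * n) a b (curve_set Z\<^sub>A' Z\<^sub>B'))"
    by simp
  also have "\<dots> = of_int (2 * ((if w \<in> Z\<^sub>A' \<union> Z\<^sub>B' then int q ^ 2 else 0) - int (card (Z\<^sub>A' \<union> Z\<^sub>B'))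
      + eps * int q * quad_char b * D))"
    unfolding char_sum_curve_set_nonzero[OF Z_disjoint(2) assms(1)] D_def w_def by simp
  also have "2 * ((if w \<in> Z\<^sub>A' \<union> Z\<^sub>B' then int q ^ 2 else 0) - int (card (Z\<^sub>A' \<union> Z\<^sub>B'))
      + eps * int q * quad_char b * D)
      = (if w \<in> Z\<^sub>A' \<union> Z\<^sub>B' then 2 * int q ^ 2 else 0)
        - 2 * int (card (Z\<^sub>A' \<union> Z\<^sub>B')) + int q * quad_char b * (eps * (2 * D))"
    by (simp add: algebra_simps)
  also have "\<dots> = (if w \<in> Z\<^sub>A' \<union> Z\<^sub>B' then 2 * int q ^ 2 else 0) - int q ^ 2 - 1 + int q ^ 2 * quad_char b * m"
    unfolding D card_Z' by (simp add: algebra_simps power2_eq_square)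
  finally show ?thesis
    by (simp only: m_def)
qed

lemma type_Q_base_C: "type_Q \<zeta> p n base_C"
proof (rule type_Q_I)
  show "base_C \<subseteq> UNIV - {(0, 0)}"
    using eps_cases by (auto simp: base_C_def mem_curve_set)
  show "(t * u, t * v) \<in> base_C" if "t \<in> Fq - {0}" "(u, v) \<in> base_C" for t u v
    using that curve_set_scale[of t u v] by (auto simp: base_C_def quad_char_mult quad_char_Fq)
  have "card base_C = card ({0 :: 'a} \<times> {y :: 'a. quad_char y = eps}) + card (curve_set Z\<^sub>A Z\<^sub>B)"
    unfolding base_C_def by (rule card_Un_disjoint) (use base_C_disjoint in auto)
  then have "4 * int (card base_C) = 2 * (2 * int (card {y :: 'a. quad_char y = eps}))
      + 2 * (2 * int (card (curve_set Z\<^sub>A Z\<^sub>B)))"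
    by (simp add: card_cartesian_product)
  also have "\<dots> = 2 * (int q ^ 2 - 1) + (int q ^ 2 - 1) * (2 * int (card (Z\<^sub>A \<union> Z\<^sub>B)))"
    unfolding card_quad_char_eq[OF eps_cases] card_curve_set[OF Z_disjoint(1)] by simp
  also have "\<dots> = int q ^ 4 - 1"
    unfolding card_Z by (simp add: algebra_simps flip: power_add)
  finally show "4 * int (card base_C) = int q ^ 4 - 1" .
next
  fix a b :: 'a assume ab: "(a, b) \<noteq> (0, 0)"
  show "\<exists>k \<in> {int q ^ 2 - 1, - 3 * int q ^ 2 - 1}. 4 * char_sum \<zeta> p (2 * n) a b base_C = of_int k"
  proof (cases "b = 0")
    case True
    with ab have a: "a \<noteq> 0"
      by simp
    have "4 * char_sum \<zeta> p (2 * n) a b base_C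
        = of_int (2 * (int q ^ 2 - 1) - 2 * int (card (Z\<^sub>A \<union> Z\<^sub>B)))"
      unfolding four_char_sum_base_C True char_sum_curve_set_0[OF Z_disjoint(1) a] card_diff_Z by simp
    also have "\<dots> = of_int (int q ^ 2 - 1)"
      unfolding card_Z by simp
    finally show ?thesis
      by blast
  next
    case False
    define w where "w = - (a ^ q) / b"
    \<comment> \<open>The last factor is the difference of the two signs of \<open>w\<close>: it is
      0 on the union, where \<open>2 * q ^ 2\<close> is added, and 2 or -2 off it.\<close>
    have "(if w \<in> Z\<^sub>A \<union> Z\<^sub>B then 2 * int q ^ 2 else 0) - int q ^ 2 - 1
       + int q ^ 2 * quad_char b *
         (\<eta> (T w) + zero_ind (T w) - \<eta> (T (\<delta> * w)) + zero_ind (T (\<delta> * w)))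
       \<in> {int q ^ 2 - 1, - 3 * int q ^ 2 - 1}"
      by (rule disjE[OF quad_char_cases[OF False]]; rule eta_values[of "T w"]; rule eta_values[of "T (\<delta> * w)"])
         (simp_all add: Z\<^sub>A_def Z\<^sub>B_def \<eta>\<^sub>1_def \<eta>\<^sub>2_def)
    then show ?thesis
      using four_char_sum_base_C_nonzero[OF False, of a] unfolding w_def by blast
  qed
next
  fix k assume "k \<in> {int q ^ 2 - 1, - 3 * int q ^ 2 - 1}"
  then show "\<exists>a b. (a, b) \<noteq> (0, 0) \<and> 4 * char_sum \<zeta> p (2 * n) a b base_C = of_int k"
  proof (elim insertE emptyE)
    assume "k = int q ^ 2 - 1"
    \<comment> \<open>For \<open>a = 0\<close> the slope \<open>w\<close> is 0, which lies outside
      the union and makes the last factor 2; the character of \<open>b\<close> then selects the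
      value, so 1 and \<omega> yield one each.\<close>
    then have "4 * char_sum \<zeta> p (2 * n) 0 1 base_C = of_int k"
      using four_char_sum_base_C_nonzero[of 1 0] q_pos
      by (simp add: zero_power Z\<^sub>A_def Z\<^sub>B_def \<eta>\<^sub>1_def \<eta>\<^sub>2_def zero_ind_def)
    then show ?thesis
      by (intro exI[of _ 0] exI[of _ 1]) simp
  next
    assume "k = - 3 * int q ^ 2 - 1"
    then have "4 * char_sum \<zeta> p (2 * n) 0 \<omega> base_C = of_int k"
      using four_char_sum_base_C_nonzero[of \<omega> 0] q_pos
      by (simp add: zero_power Z\<^sub>A_def Z\<^sub>B_def \<eta>\<^sub>1_def \<eta>\<^sub>2_def zero_ind_def)
    then show ?thesis
      by (intro exI[of _ 0] exI[of _ \<omega>]) simp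
  qed
qed

lemma type_Q_curve_set': "type_Q \<zeta> p n (curve_set Z\<^sub>A' Z\<^sub>B')"
proof (rule type_Q_I)
  show "curve_set Z\<^sub>A' Z\<^sub>B' \<subseteq> UNIV - {(0, 0)}"
    by (auto simp: mem_curve_set)
  show "(t * u, t * v) \<in> curve_set Z\<^sub>A' Z\<^sub>B'" if "t \<in> Fq - {0}" "(u, v) \<in> curve_set Z\<^sub>A' Z\<^sub>B'" for t u v
    using that by (rule curve_set_scale)
  have "4 * int (card (curve_set Z\<^sub>A' Z\<^sub>B')) = 2 * (2 * int (card (curve_set Z\<^sub>A' Z\<^sub>B')))"
    by simp
  also have "\<dots> = (int q ^ 2 - 1) * (2 * int (card (Z\<^sub>A' \<union> Z\<^sub>B')))"
    unfolding card_curve_set[OF Z_disjoint(2)] by simp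
  also have "\<dots> = int q ^ 4 - 1"
    unfolding card_Z' by (simp add: algebra_simps flip: power_add)
  finally show "4 * int (card (curve_set Z\<^sub>A' Z\<^sub>B')) = int q ^ 4 - 1" .
  \<comment> \<open>Here the two slope sets differ in size by \<open>q\<close>, so the term with
    \<open>quad_char a\<close> has order \<open>q ^ 2\<close>; both values already occur for
    \<open>b = 0\<close>.\<close>
  have zero: "4 * char_sum \<zeta> p (2 * n) a 0 (curve_set Z\<^sub>A' Z\<^sub>B')
      = of_int (2 * eps * int q ^ 2 * quad_char a - int q ^ 2 - 1)" if "a \<noteq> 0" for a
  proof -
    have "4 * char_sum \<zeta> p (2 * n) a 0 (curve_set Z\<^sub>A' Z\<^sub>B')
        = 2 * (2 * char_sum \<zeta> p (2 * n) a 0 (curve_set Z\<^sub>A' Z\<^sub>B'))"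
      by simp
    also have "\<dots> = of_int (2 * (eps * int q * quad_char a * int q) - 2 * int (card (Z\<^sub>A' \<union> Z\<^sub>B')))"
      unfolding char_sum_curve_set_0[OF Z_disjoint(2) that] card_diff_Z' by simp
    also have "\<dots> = of_int (2 * eps * int q ^ 2 * quad_char a - int q ^ 2 - 1)"
      unfolding card_Z' by (simp add: power2_eq_square)
    finally show ?thesis .
  qed
  show "\<exists>k \<in> {int q ^ 2 - 1, - 3 * int q ^ 2 - 1}. 4 * char_sum \<zeta> p (2 * n) a b (curve_set Z\<^sub>A' Z\<^sub>B') = of_int k"
    if ab: "(a, b) \<noteq> (0, 0)" for a b
  proof (cases "b = 0")
    case True
    with ab have a: "a \<noteq> 0"
      by simp
    have "2 * eps * int q ^ 2 * quad_char a - int q ^ 2 - 1 \<in> {int q ^ 2 - 1, - 3 * int q ^ 2 - 1}"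
      using eps_cases quad_char_cases[OF a] by auto
    then show ?thesis
      using zero[OF a] True by blast
  next
    case False
    define w where "w = - (a ^ q) / b"
    have "(if w \<in> Z\<^sub>A' \<union> Z\<^sub>B' then 2 * int q ^ 2 else 0) - int q ^ 2 - 1
       + int q ^ 2 * quad_char b *
         (\<eta> (T w) + zero_ind (T w) + \<eta> (T (\<delta> * w)) - zero_ind (T (\<delta> * w)))
       \<in> {int q ^ 2 - 1, - 3 * int q ^ 2 - 1}"
      by (rule disjE[OF quad_char_cases[OF False]]; rule eta_values[of "T w"]; rule eta_values[of "T (\<delta> * w)"])
         (simp_all add: Z\<^sub>A'_def Z\<^sub>B'_def \<eta>\<^sub>1_def \<eta>\<^sub>2_def)
    then show ?thesis
      using four_char_sum_curve_set'[OF False, of a] unfolding w_def by blast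
  qed
  show "\<exists>a b. (a, b) \<noteq> (0, 0) \<and> 4 * char_sum \<zeta> p (2 * n) a b (curve_set Z\<^sub>A' Z\<^sub>B') = of_int k"
    if "k \<in> {int q ^ 2 - 1, - 3 * int q ^ 2 - 1}" for k
  proof -
    have "k = 2 * eps * int q ^ 2 * quad_char (1 :: 'a) - int q ^ 2 - 1
        \<or> k = 2 * eps * int q ^ 2 * quad_char \<omega> - int q ^ 2 - 1"
      using that eps_cases by auto
    then show ?thesis
      using zero[of 1] zero[of \<omega>] by (metis omega_neq_0 prod.inject zero_neq_one)
  qed
qed

section \<open>The linear map carrying the first two sets to the other two\<close>

definition twist :: "'a \<times> 'a \<Rightarrow> 'a \<times> 'a" where
  "twist = (\<lambda>(u, v). (\<omega> * u, \<omega> ^ q * v))"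

lemma inj_twist: "inj twist"
  by (auto simp: twist_def inj_def)

lemma char_sum_twist:
  "char_sum \<zeta> p (2 * n) a b (twist ` E) = char_sum \<zeta> p (2 * n) (a * \<omega>) (b * \<omega> ^ q) E"
  unfolding char_sum_def
  by (subst sum.reindex[OF inj_on_subset[OF inj_twist subset_UNIV]])
     (auto intro!: sum.cong simp: twist_def mult.assoc)

text \<open>The map is injective and commutes with scalars, and its effect on character sums is to
  permute the nonzero pairs \<open>(a, b)\<close>.\<close>

lemma type_Q_twist:
  assumes "type_Q \<zeta> p n E"
  shows "type_Q \<zeta> p n (twist ` E)"
  unfolding type_Q_def
proof (intro conjI)
  show "twist ` E \<subseteq> UNIV - {(0, 0)}"
    using assms by (auto simp: type_Q_def twist_def)
  show "\<forall>t\<in>subfield_q (p ^ n) - {0}. \<forall>(x, y)\<in>twist ` E. (t * x, t * y) \<in> twist ` E"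
  proof (intro ballI)
    fix t z assume t: "t \<in> subfield_q (p ^ n) - {0 :: 'a}" and "z \<in> twist ` E"
    then obtain u v where uv: "(u, v) \<in> E" "z = (\<omega> * u, \<omega> ^ q * v)"
      by (auto simp: twist_def)
    then have "(t * u, t * v) \<in> E"
      using assms t by (auto simp: type_Q_def)
    then have "twist (t * u, t * v) \<in> twist ` E"
      by (rule imageI)
    then show "case z of (x, y) \<Rightarrow> (t * x, t * y) \<in> twist ` E"
      using uv(2) by (simp add: twist_def mult_ac)
  qed
  show "real (card (twist ` E)) = (real (p ^ n) ^ 4 - 1) / 4"
    using assms by (simp add: type_Q_def card_image inj_on_subset[OF inj_twist])
  have "{char_sum \<zeta> p (2 * n) a b (twist ` E) | a b. (a, b) \<noteq> (0, 0)}
      = {char_sum \<zeta> p (2 * n) a b E | a b. (a, b) \<noteq> (0, 0)}" (is "?L = ?R")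
  proof
    show "?L \<subseteq> ?R"
    proof
      fix x assume "x \<in> ?L"
      then obtain a b where "x = char_sum \<zeta> p (2 * n) (a * \<omega>) (b * \<omega> ^ q) E" "(a, b) \<noteq> (0, 0)"
        unfolding char_sum_twist by auto
      then show "x \<in> ?R"
        by (intro CollectI exI[of _ "a * \<omega>"] exI[of _ "b * \<omega> ^ q"]) auto
    qed
    show "?R \<subseteq> ?L"
    proof
      fix x assume "x \<in> ?R"
      then obtain a b where "x = char_sum \<zeta> p (2 * n) a b E" "(a, b) \<noteq> (0, 0)"
        by auto
      then show "x \<in> ?L"
        unfolding char_sum_twist by (intro CollectI exI[of _ "a / \<omega>"] exI[of _ "b / \<omega> ^ q"]) auto
    qed
  qed
  then show "{char_sum \<zeta> p (2 * n) a b (twist ` E) | a b. (a, b) \<noteq> (0, 0)}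
      = {(of_nat (p ^ n) ^ 2 - 1) / 4, (- 3 * of_nat (p ^ n) ^ 2 - 1) / 4}"
    using assms by (simp add: type_Q_def)
qed

text \<open>The slope \<open>v / u ^ q\<close> is preserved while \<open>u\<close> changes its
  square class.\<close>

lemma twist_curve_set: "twist ` curve_set Z1 Z2 = curve_set Z2 Z1"
proof -
  have "(u, v) \<in> twist ` curve_set Z1 Z2 \<longleftrightarrow> (u, v) \<in> curve_set Z2 Z1" for u v
  proof -
    have "(u, v) \<in> twist ` curve_set Z1 Z2 \<longleftrightarrow> (u / \<omega>, v / \<omega> ^ q) \<in> curve_set Z1 Z2"
      by (auto simp: twist_def image_iff intro!: bexI[of _ "(u / \<omega>, v / \<omega> ^ q)"])
    also have "quad_char (u / \<omega>) = - quad_char u"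
      using quad_char_mult[of "u / \<omega>" \<omega>] by simp
    then have "(u / \<omega>, v / \<omega> ^ q) \<in> curve_set Z1 Z2 \<longleftrightarrow> (u, v) \<in> curve_set Z2 Z1"
      using quad_char_cases[of u] by (auto simp: mem_curve_set power_divide)
    finally show ?thesis .
  qed
  then show ?thesis
    by auto
qed

end

context quadratic_extension
begin

text \<open>The norm of \<omega>, a generator of the nonzero elements of the small field and hence a
  nonsquare there.\<close>

definition \<nu> :: 'a where
  "\<nu> = \<omega> ^ (q + 1)"

lemma nu_neq_0 [simp]: "\<nu> \<noteq> 0"
  by (simp add: \<nu>_def)

lemma nu_in_Fq: "\<nu> \<in> Fq"
  unfolding \<nu>_def by (simp only: Fq_omega_power_iff dvd_refl)

lemma eta_nu: "\<eta> \<nu> = - 1"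
  using eta_omega_power[of 1] by (simp add: \<nu>_def)

lemma eta_square: "r \<in> Fq \<Longrightarrow> r \<noteq> 0 \<Longrightarrow> \<eta> (r ^ 2 * s) = \<eta> s" if "s \<in> Fq" for s
  using quad_char_q_cases[of r q] that by (auto simp: eta_mult eta_power Fq_power)

lemma eta_T_square_mult: "r \<in> Fq \<Longrightarrow> r \<noteq> 0 \<Longrightarrow> \<eta> (T (r ^ 2 * z)) = \<eta> (T z)"
  by (simp add: T_mult Fq_power eta_square T_in_Fq)

lemma eta_T_nu_mult: "\<eta> (T (\<nu> * z)) = - \<eta> (T z)"
  by (simp add: T_mult nu_in_Fq eta_mult T_in_Fq eta_nu)

lemma power_q_plus_1_in_Fq: "(x :: 'a) ^ (q + 1) \<in> Fq"
  by (simp add: mem_Fq power_mult_distrib power_q_q mult.commute)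

section \<open>Exponents of the primitive element\<close>

text \<open>Division by \<open>\<omega> ^ k\<close> leaves a nonzero square, that is, an even power
  of \<omega>.\<close>

lemma cyc_class_2: "cyc_class \<omega> 2 k = {y. quad_char y = (- 1) ^ k}"
proof
  show "cyc_class \<omega> 2 k \<subseteq> {y. quad_char y = (- 1) ^ k}"
    by (auto simp: cyc_class_def quad_char_mult quad_char_power)
  show "{y. quad_char y = (- 1) ^ k} \<subseteq> cyc_class \<omega> 2 k"
  proof
    fix y :: 'a assume y: "y \<in> {y. quad_char y = (- 1) ^ k}"
    then have "y \<noteq> 0"
      by auto
    then have "y / \<omega> ^ k \<noteq> 0"
      by simp
    moreover have "quad_char (y / \<omega> ^ k) * quad_char (\<omega> ^ k) = quad_char y"
      by (simp flip: quad_char_mult)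
    then have "quad_char (y / \<omega> ^ k) = 1"
      using y by (simp add: quad_char_omega_power)
    ultimately obtain j where j: "y / \<omega> ^ k = \<omega> ^ j" "even j"
      by (metis nonzero_powerE quad_char_omega_power neg_one_odd_power one_neq_neg_one)
    then obtain i where "j = 2 * i"
      by (elim evenE)
    then have "y = \<omega> ^ k * \<omega> ^ (2 * i)"
      using j(1) by (simp add: divide_eq_eq mult.commute)
    then have "y = \<omega> ^ k * (\<omega> ^ 2) ^ i"
      by (simp only: power_mult)
    then show "y \<in> cyc_class \<omega> 2 k"
      by (auto simp: cyc_class_def)
  qed
qed

abbreviation "indices \<equiv> {0..2 * int q + 1}"

definition M :: int where
  "M = 2 * (int q + 1)"

text \<open>\<open>\<omega> powi M\<close> equals \<open>\<nu> ^ 2\<close>, so a change of exponent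
  by a multiple of \<open>M\<close> is a factor that is a nonzero square of the small field.\<close>

lemma omega_powi_mod:
  obtains r where "r \<in> Fq" "r \<noteq> 0" "\<omega> powi i = r ^ 2 * \<omega> powi (i mod M)"
proof
  define k where "k = i div M"
  define m where "m = i mod M"
  define r where "r = \<nu> powi k"
  have nu: "\<omega> powi (int q + 1) = \<nu>"
    using power_int_of_nat[of \<omega> "q + 1"] by (simp add: \<nu>_def add.commute)
  have "i = M * k + m"
    by (simp only: k_def m_def mult_div_mod_eq)
  also have "M * k = (int q + 1) * k * 2"
    by (simp add: M_def)
  finally have "\<omega> powi i = \<omega> powi ((int q + 1) * k * 2) * \<omega> powi m"
    by (simp only: power_int_add[OF disjI1[OF omega_neq_0]])
  also have "\<omega> powi ((int q + 1) * k * 2) = r ^ 2"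
    unfolding power_int_mult nu r_def by simp
  finally show "\<omega> powi i = r ^ 2 * \<omega> powi (i mod M)"
    by (simp only: m_def)
  show "r \<noteq> 0"
    by (simp add: r_def)
  show "r \<in> Fq"
    unfolding r_def power_int_def by (simp add: Fq_power Fq_inverse nu_in_Fq)
qed

lemma mod_in_indices: "i mod M \<in> indices"
proof -
  have indices: "x \<in> indices" if "0 \<le> x" "x < M" for x
    using that by (auto simp: M_def)
  have "M > 0"
    by (simp add: M_def)
  then show ?thesis
    by (intro indices) simp_all
qed

lemma eta_T_powi_mod:
  "\<eta> (T (z * \<omega> powi (i mod M))) = \<eta> (T (z * \<omega> powi i))"
proof -
  obtain r where "r \<in> Fq" "r \<noteq> 0" "\<omega> powi i = r ^ 2 * \<omega> powi (i mod M)"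
    by (rule omega_powi_mod)
  then show ?thesis
    using eta_T_square_mult[of r "z * \<omega> powi (i mod M)"] by (simp add: mult_ac)
qed

lemma nonzero_eq_powi_mult_square:
  assumes "z \<noteq> (0 :: 'a)"
  obtains i r where "i \<in> indices" "r \<in> Fq" "r \<noteq> 0" "z = r ^ 2 * \<omega> powi i"
proof -
  obtain k where k: "z = \<omega> ^ k"
    using assms by (rule nonzero_powerE)
  obtain r where "r \<in> Fq" "r \<noteq> 0" "\<omega> powi int k = r ^ 2 * \<omega> powi (int k mod M)"
    by (rule omega_powi_mod)
  then show ?thesis
    using that[OF mod_in_indices[of "int k"], of r] k by simp
qed

lemma mem_shift_mod:
  assumes "I \<subseteq> indices"
  shows "j \<in> shift_mod q d I \<longleftrightarrow> j \<in> indices \<and> (j + d) mod M \<in> I"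
proof
  assume "j \<in> shift_mod q d I"
  then obtain i where i: "i \<in> I" "j = (i - d) mod M"
    by (auto simp: shift_mod_def M_def)
  then have "(j + d) mod M = i mod M"
    by (simp add: mod_add_left_eq)
  also have "\<dots> = i"
    using i(1) assms by (intro mod_pos_pos_trivial) (auto simp: M_def)
  finally show "j \<in> indices \<and> (j + d) mod M \<in> I"
    using i mod_in_indices[of "i - d"] by simp
next
  assume j: "j \<in> indices \<and> (j + d) mod M \<in> I"
  have "((j + d) mod M - d) mod M = j mod M"
    by (simp add: mod_diff_left_eq)
  also have "\<dots> = j"
    using j by (intro mod_pos_pos_trivial) (auto simp: M_def)
  finally have eq: "((j + d) mod M - d) mod M = j" .
  show "j \<in> shift_mod q d I"
    unfolding shift_mod_def M_def[symmetric]
    by (intro image_eqI[of _ _ "(j + d) mod M"]) (use eq j in simp_all)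
qed

lemma I1_eq: "I1 \<omega> q = {i \<in> indices. \<eta> (T (\<omega> powi i)) = 0}"
  by (simp add: I1_def)

lemma I2_eq: "I2 \<omega> q = {i \<in> indices. \<eta> (T (\<omega> powi i)) = 1}"
  by (simp add: I2_def nonzero_squares_q_iff)

lemma eta_T_powi_add:
  "\<eta> (T (\<omega> powi ((j + d) mod M))) = \<eta> (T (\<omega> powi d * \<omega> powi j))"
  using eta_T_powi_mod[of 1 "j + d"] by (simp add: power_int_add mult.commute)

lemma X1_eq:
  "X1 \<omega> q d = {j \<in> indices. \<eta> (T (\<omega> powi j)) = 0 \<and> \<eta> (T (\<omega> powi d * \<omega> powi j)) = 1 \<or>
     \<eta> (T (\<omega> powi j)) = 1 \<and> \<eta> (T (\<omega> powi d * \<omega> powi j)) = 0}"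
proof -
  have "I1 \<omega> q \<subseteq> indices" "I2 \<omega> q \<subseteq> indices"
    by (auto simp: I1_def I2_def)
  then show ?thesis
    using mod_in_indices
    by (auto simp: X1_def mem_shift_mod I1_eq I2_eq eta_T_powi_add simp del: quad_char_q_eq_0_iff)
qed

lemma X3_eq:
  "X3 \<omega> q d = {j \<in> indices. \<eta> (T (\<omega> powi j)) = 1 \<and> \<eta> (T (\<omega> powi d * \<omega> powi j)) = 1}"
proof -
  have "I2 \<omega> q \<subseteq> indices"
    by (auto simp: I2_def)
  then show ?thesis
    using mod_in_indices by (auto simp: X3_def mem_shift_mod I2_eq eta_T_powi_add)
qed

text \<open>A shift of the exponent by \<open>q + 1\<close> multiplies by the nonsquare \<nu>; the
  reduction modulo \<open>M\<close> is invisible to \<eta>.\<close>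

lemma eta_T_powi_antipode:
  "\<eta> (T (\<omega> powi ((c + int q + 1) mod M) * z)) = - \<eta> (T (\<omega> powi c * z))"
proof -
  have "\<omega> powi (int q + 1) = \<nu>"
    using power_int_of_nat[of \<omega> "q + 1"] by (simp add: \<nu>_def add.commute)
  then have "\<omega> powi (c + int q + 1) * z = \<nu> * (\<omega> powi c * z)"
    using power_int_add[of \<omega> c "int q + 1"] by (simp add: add.assoc mult_ac)
  moreover have "\<eta> (T (\<omega> powi ((c + int q + 1) mod M) * z)) = \<eta> (T (\<omega> powi (c + int q + 1) * z))"
    using eta_T_powi_mod[of z "c + int q + 1"] by (simp only: mult.commute[of z])
  ultimately show ?thesis
    by (simp only: eta_T_nu_mult)
qed

text \<open>For fixed \<open>x\<close> and \<open>i\<close> the product of the coordinates is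
  constant, namely \<open>x ^ 2 * \<omega> powi i\<close>.\<close>

definition hyperbola_set :: "nat \<Rightarrow> int set \<Rightarrow> ('a \<times> 'a) set" where
  "hyperbola_set k I = {(x * y, x * inverse y * \<omega> powi i) | x y i.
     x \<in> Fq - {0} \<and> y \<in> cyc_class \<omega> 2 k \<and> i \<in> I}"

lemma hyperbola_point:
  assumes "x \<in> Fq" "y \<noteq> 0"
  shows "x * inverse y * w = w / y ^ (q + 1) * (x * y) ^ q"
  using assms by (simp add: power_mult_distrib mem_Fq field_simps)

text \<open>A point has slope \<open>\<omega> powi i / y ^ (q + 1)\<close>. For \<open>y\<close> in
  class \<open>k\<close> the norm \<open>y ^ (q + 1)\<close> is \<open>\<nu> ^ k\<close> times a
  square of the small field, so \<open>\<nu> ^ k\<close> times the slope agrees with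
  \<open>\<omega> powi i\<close> up to such a square, under which \<open>W\<close> is
  stable.\<close>

lemma hyperbola_set_eq:
  assumes W: "\<And>r z. r \<in> Fq \<Longrightarrow> r \<noteq> 0 \<Longrightarrow> z \<in> W \<Longrightarrow> r ^ 2 * z \<in> W"
  shows "hyperbola_set k {i \<in> indices. \<omega> powi i \<in> W}
    = {(u, z * u ^ q) | u z. quad_char u = (- 1) ^ k \<and> z \<noteq> 0 \<and> \<nu> ^ k * z \<in> W}"
    (is "?L = ?R")
proof
  show "?L \<subseteq> ?R"
  proof
    fix P assume "P \<in> ?L"
    then obtain x y i where P: "P = (x * y, x * inverse y * \<omega> powi i)" "x \<in> Fq" "x \<noteq> 0"
      "y \<in> cyc_class \<omega> 2 k" "\<omega> powi i \<in> W"
      by (auto simp: hyperbola_set_def)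
    then obtain j where y: "y = \<omega> ^ k * (\<omega> ^ 2) ^ j"
      by (auto simp: cyc_class_def)
    then have "y \<noteq> 0"
      by simp
    define z where "z = \<omega> powi i / y ^ (q + 1)"
    define r where "r = inverse ((\<omega> ^ j) ^ (q + 1))"
    have "r \<in> Fq" "r \<noteq> 0"
      by (simp_all only: r_def Fq_inverse power_q_plus_1_in_Fq) simp
    have "y ^ (q + 1) = (\<omega> ^ (q + 1)) ^ k * ((\<omega> ^ j) ^ (q + 1)) ^ 2"
      unfolding y power_mult_distrib
      by (simp only: power_mult[symmetric] mult.commute mult.left_commute)
    then have "\<nu> ^ k * z = r ^ 2 * \<omega> powi i"
      by (simp add: z_def r_def \<nu>_def power_inverse divide_inverse del: power_Suc power_add)
    then have "\<nu> ^ k * z \<in> W"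
      using W \<open>r \<in> Fq\<close> \<open>r \<noteq> 0\<close> P(5) by simp
    moreover have "quad_char (x * y) = (- 1) ^ k"
      using P by (simp add: quad_char_mult quad_char_Fq cyc_class_2)
    moreover have "P = (x * y, z * (x * y) ^ q)"
      using P(1) hyperbola_point[OF P(2) \<open>y \<noteq> 0\<close>] by (simp add: z_def)
    moreover have "z \<noteq> 0"
      using \<open>y \<noteq> 0\<close> by (simp add: z_def)
    ultimately show "P \<in> ?R"
      by blast
  qed
  show "?R \<subseteq> ?L"
  proof
    fix P assume "P \<in> ?R"
    then obtain u z where P: "P = (u, z * u ^ q)" "u \<in> cyc_class \<omega> 2 k" "z \<noteq> 0" "\<nu> ^ k * z \<in> W"
      by (auto simp: cyc_class_2)
    then obtain j where u: "u = \<omega> ^ k * (\<omega> ^ 2) ^ j"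
      by (auto simp: cyc_class_def)
    have "\<nu> ^ k * z \<noteq> 0"
      using P(3) by simp
    then obtain i g where g: "i \<in> indices" "g \<in> Fq" "g \<noteq> 0" "\<nu> ^ k * z = g ^ 2 * \<omega> powi i"
      by (rule nonzero_eq_powi_mult_square)
    \<comment> \<open>A square \<open>v ^ 2\<close> is the product of \<open>x0 = v ^ (q + 1)\<close> in the small field and \<open>t = v ^ 2 / x0\<close>,
      which has norm \<open>1\<close>, so \<open>u\<close> can be rescaled to any square norm within the small field.\<close>
    have "\<omega> powi i = inverse g ^ 2 * (\<nu> ^ k * z)"
      using g by (simp add: power_inverse)
    moreover have "inverse g ^ 2 * (\<nu> ^ k * z) \<in> W"
      using g P(4) by (intro W) (simp_all add: Fq_inverse)
    ultimately have "\<omega> powi i \<in> W"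
      by simp
    define v where "v = \<omega> ^ j"
    define x0 where "x0 = v ^ (q + 1)"
    define t where "t = v ^ 2 / x0"
    \<comment> \<open>Division by \<open>g\<close> gives \<open>y\<close> the norm
      \<open>\<nu> ^ k / g ^ 2\<close>, so that index \<open>i\<close> produces the slope
      \<open>z\<close>; the factor \<open>x0 * g\<close> then restores \<open>u\<close>.\<close>
    define y where "y = \<omega> ^ k * t / g"
    have v: "v \<noteq> 0" "x0 \<noteq> 0" "x0 \<in> Fq"
      by (simp_all only: v_def x0_def power_q_plus_1_in_Fq) simp_all
    have "x0 ^ (q + 1) = x0 ^ 2"
      using v(3) by (simp add: mem_Fq power2_eq_square)
    moreover have "(v ^ 2) ^ (q + 1) = x0 ^ 2"
      unfolding x0_def by (simp only: power_mult[symmetric] mult.commute)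
    ultimately have t: "t ^ (q + 1) = 1"
      using v(2) by (simp add: t_def power_divide del: power_Suc)
    have gq: "g ^ (q + 1) = g ^ 2"
      using g(2) by (simp add: mem_Fq power2_eq_square)
    have "y ^ (q + 1) = \<nu> ^ k * t ^ (q + 1) / g ^ (q + 1)"
      unfolding y_def \<nu>_def power_divide power_mult_distrib
      by (simp only: power_mult[symmetric] mult.commute)
    then have yq: "y ^ (q + 1) = \<nu> ^ k / g ^ 2"
      by (simp only: t gq mult_1_right)
    have y0: "y \<noteq> 0"
      using v g by (simp add: y_def t_def)
    have "quad_char (inverse g) = 1" "quad_char (inverse x0) = 1"
      using v g by (simp_all add: quad_char_Fq Fq_inverse)
    moreover have "quad_char v * quad_char v = 1"
      using quad_char_cases[OF v(1)] by auto
    ultimately have "quad_char y = (- 1) ^ k"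
      by (simp add: y_def t_def divide_inverse quad_char_mult quad_char_omega_power power2_eq_square)
    then have yc: "y \<in> cyc_class \<omega> 2 k"
      by (simp add: cyc_class_2)
    have xy: "(x0 * g) * y = u"
      using v g by (simp add: y_def t_def u v_def power_mult[symmetric] mult.commute)
    have x: "x0 * g \<in> Fq - {0}"
      using v g by (simp add: Fq_mult)
    have "\<omega> powi i / y ^ (q + 1) = z"
      unfolding yq using g by (simp add: field_simps)
    then have "P = ((x0 * g) * y, (x0 * g) * inverse y * \<omega> powi i)"
      using hyperbola_point[of "x0 * g" y "\<omega> powi i"] x y0 unfolding P(1) xy by simp
    then show "P \<in> ?L"
      unfolding hyperbola_set_def using x yc g(1) \<open>\<omega> powi i \<in> W\<close> by blast
  qed
qed

section \<open>The spread\<close>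

definition line :: "'a \<Rightarrow> ('a \<times> 'a) set" where
  "line y = {(x, y * x ^ q) | x. True}"

definition line_inf :: "('a \<times> 'a) set" where
  "line_inf = {(0, x) | x. True}"

lemma spread_family_eq: "spread_family q = insert line_inf (range line)"
  by (auto simp: spread_family_def line_def line_inf_def)

lemma inj_line: "inj line"
proof (rule injI)
  fix y y' assume "line y = line y'"
  moreover have "(1, y) \<in> line y"
    by (auto simp: line_def intro: exI[of _ 1])
  ultimately have "(1, y) \<in> line y'"
    by simp
  then show "y = y'"
    by (auto simp: line_def)
qed

lemma line_inf_neq: "line_inf \<noteq> line y"
proof
  assume eq: "line_inf = line y"
  have "(1, y * 1 ^ q) \<in> line y"
    unfolding line_def by blast
  then have "(1, y * 1 ^ q) \<in> line_inf"
    by (simp only: eq)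
  then show False
    by (simp add: line_inf_def)
qed

lemma card_spread_family: "card (spread_family q :: ('a \<times> 'a) set set) = q ^ 2 + 1"
  using inj_line line_inf_neq by (simp add: spread_family_eq card_insert_if card_image card_UNIV image_iff)

lemma omega_not_in_Fq: "\<omega> \<notin> Fq"
  using quad_char_Fq[of \<omega>] by auto

lemma independent_1_omega:
  assumes "s \<in> Fq" "t \<in> Fq" "s + t * \<omega> = 0"
  shows "s = 0 \<and> t = 0"
proof -
  have "t = 0"
  proof (rule ccontr)
    assume "t \<noteq> 0"
    then have "\<omega> = (0 - s) / t"
      using assms(3) by (simp add: field_simps add_eq_0_iff)
    then show False
      using omega_not_in_Fq Fq_divide[of "0 - s" t] Fq_diff[of 0 s] assms by simp
  qed
  then show ?thesis
    using assms by simp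
qed

text \<open>The \<open>q ^ 2\<close> combinations are distinct by independence and therefore fill
  the field.\<close>

lemma basis_1_omega: obtains s t where "s \<in> Fq" "t \<in> Fq" "x = s + t * \<omega>"
proof -
  define f where "f = (\<lambda>(s, t). s + t * \<omega>)"
  have "inj_on f (Fq \<times> Fq)"
  proof (rule inj_onI, clarify)
    fix s t s' t' assume *: "s \<in> Fq" "t \<in> Fq" "s' \<in> Fq" "t' \<in> Fq" "f (s, t) = f (s', t')"
    then have "(s - s') + (t - t') * \<omega> = 0"
      by (simp add: f_def algebra_simps)
    then have "s - s' = 0 \<and> t - t' = 0"
      using * by (intro independent_1_omega Fq_diff)
    then show "s = s' \<and> t = t'"
      by simp
  qed
  then have "card (f ` (Fq \<times> Fq)) = card (UNIV :: 'a set)"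
    by (simp add: card_image card_cartesian_product card_Fq card_UNIV power2_eq_square)
  then have "f ` (Fq \<times> Fq) = UNIV"
    by (intro card_subset_eq) auto
  then have "x \<in> f ` (Fq \<times> Fq)"
    by simp
  then show ?thesis
    using that by (auto simp: f_def)
qed

text \<open>The map from \<open>x\<close> to \<open>(x, y * x ^ q)\<close> is linear over the small
  field, so the images of 1 and \<omega> span the line.\<close>

lemma two_dim_line: "two_dim_subspace q (line y)"
  unfolding two_dim_subspace_def
proof (intro exI conjI ballI impI)
  fix s t assume st: "s \<in> Fq" "t \<in> Fq" "s * 1 + t * \<omega> = 0 \<and> s * y + t * (y * \<omega> ^ q) = 0"
  then show "s = 0" "t = 0"
    using independent_1_omega[of s t] by simp_all
next
  show "line y = {(s * 1 + t * \<omega>, s * y + t * (y * \<omega> ^ q)) | s t. s \<in> Fq \<and> t \<in> Fq}" (is "_ = ?R")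
  proof
    show "line y \<subseteq> ?R"
    proof
      fix P assume "P \<in> line y"
      then obtain x where P: "P = (x, y * x ^ q)"
        by (auto simp: line_def)
      obtain s t where st: "s \<in> Fq" "t \<in> Fq" "x = s + t * \<omega>"
        by (rule basis_1_omega)
      then have "P = (s * 1 + t * \<omega>, s * y + t * (y * \<omega> ^ q))"
        by (simp add: P power_add_q power_mult_distrib mem_Fq algebra_simps)
      then show "P \<in> ?R"
        using st by blast
    qed
    show "?R \<subseteq> line y"
    proof
      fix P assume "P \<in> ?R"
      then obtain s t where st: "s \<in> Fq" "t \<in> Fq" "P = (s * 1 + t * \<omega>, s * y + t * (y * \<omega> ^ q))"
        by blast
      then have "P = (s + t * \<omega>, y * (s + t * \<omega>) ^ q)"
        by (simp add: power_add_q power_mult_distrib mem_Fq algebra_simps)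
      then show "P \<in> line y"
        unfolding line_def by blast
    qed
  qed
qed

lemma two_dim_line_inf: "two_dim_subspace q line_inf"
  unfolding two_dim_subspace_def
proof (intro exI conjI ballI impI)
  fix s t assume st: "s \<in> Fq" "t \<in> Fq" "s * 0 + t * 0 = (0 :: 'a) \<and> s * 1 + t * \<omega> = 0"
  then show "s = 0" "t = 0"
    using independent_1_omega[of s t] by simp_all
next
  show "line_inf = {(s * 0 + t * 0, s * 1 + t * \<omega>) | s t. s \<in> Fq \<and> t \<in> Fq}" (is "_ = ?R")
  proof
    show "line_inf \<subseteq> ?R"
    proof
      fix P assume "P \<in> line_inf"
      then obtain x where P: "P = (0, x)"
        by (auto simp: line_inf_def)
      obtain s t where st: "s \<in> Fq" "t \<in> Fq" "x = s + t * \<omega>"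
        by (rule basis_1_omega)
      then have "P = (s * 0 + t * 0, s * 1 + t * \<omega>)"
        by (simp add: P)
      then show "P \<in> ?R"
        using st by blast
    qed
  qed (auto simp: line_inf_def)
qed

lemma is_spread_spread_family: "is_spread q (spread_family q :: ('a \<times> 'a) set set)"
  unfolding is_spread_def
proof (intro conjI ballI impI)
  show "card (spread_family q :: ('a \<times> 'a) set set) = q ^ 2 + 1"
    by (rule card_spread_family)
  show "two_dim_subspace q K" if "K \<in> spread_family q" for K :: "('a \<times> 'a) set"
    using that two_dim_line two_dim_line_inf by (auto simp: spread_family_eq)
  have 1: "line y \<inter> line y' = {(0, 0)}" if "y \<noteq> y'" for y y'
    using that q_pos by (auto simp: line_def zero_power)
  have 2: "line_inf \<inter> line y = {(0, 0)}" for y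
    using q_pos by (auto simp: line_def line_inf_def zero_power)
  show "K \<inter> L = {(0, 0)}" if "K \<in> spread_family q" "L \<in> spread_family q" "K \<noteq> L"
    for K L :: "('a \<times> 'a) set"
    using that 1 2 unfolding spread_family_eq by (metis Int_commute insertE rangeE)
qed

text \<open>Joining both orders removes the dependence on the square class of \<open>u\<close>, so
  that whole punctured lines appear.\<close>

lemma curve_set_Un_swap:
  "curve_set Z1 Z2 \<union> curve_set Z2 Z1 = {(u, z * u ^ q) | u z. u \<noteq> 0 \<and> z \<in> Z1 \<union> Z2}"
  by (auto simp: curve_set_def split: if_splits)

lemma curve_set_disjoint:
  "Z1 \<inter> Z3 = {} \<Longrightarrow> Z2 \<inter> Z4 = {} \<Longrightarrow> curve_set Z1 Z2 \<inter> curve_set Z3 Z4 = {}"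
  by (auto simp: mem_curve_set split: if_splits)

end

section \<open>From index sets to slope sets, and the enumeration of the spread\<close>

context trace_pair
begin

lemma Z_square_mult:
  assumes "r \<in> Fq" "r \<noteq> 0"
  shows "\<eta>\<^sub>1 (r ^ 2 * z) = \<eta>\<^sub>1 z" "\<eta>\<^sub>2 (r ^ 2 * z) = \<eta>\<^sub>2 z"
  using eta_T_square_mult[OF assms, of z] eta_T_square_mult[OF assms, of "\<delta> * z"]
  by (simp_all add: \<eta>\<^sub>1_def \<eta>\<^sub>2_def mult_ac)

lemma Z_nu_mult: "\<eta>\<^sub>1 (\<nu> * z) = - \<eta>\<^sub>1 z" "\<eta>\<^sub>2 (\<nu> * z) = - \<eta>\<^sub>2 z"
  using eta_T_nu_mult[of z] eta_T_nu_mult[of "\<delta> * z"]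
  by (simp_all add: \<eta>\<^sub>1_def \<eta>\<^sub>2_def mult_ac)

lemma Z_zero [simp]: "\<eta>\<^sub>1 0 = 0" "\<eta>\<^sub>2 0 = 0"
  by (simp_all add: \<eta>\<^sub>1_def \<eta>\<^sub>2_def)

lemma Z_eq_0D: "\<eta>\<^sub>1 z = 0 \<Longrightarrow> \<eta>\<^sub>2 z = 0 \<Longrightarrow> z = 0"
  using trace_pair_eq_0D by (simp add: \<eta>\<^sub>1_def \<eta>\<^sub>2_def)

lemma curve_set_eq_Un:
  "curve_set Z1 Z2 = {(u, z * u ^ q) | u z. quad_char u = 1 \<and> z \<in> Z1}
     \<union> {(u, z * u ^ q) | u z. quad_char u = - 1 \<and> z \<in> Z2}"
proof -
  have "(\<lambda>(u, z). (u, z * u ^ q)) ` ({u. quad_char u = s} \<times> Z)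
      = {(u, z * u ^ q) | u z. quad_char u = s \<and> z \<in> Z}" for s and Z :: "'a set"
    by force
  then show ?thesis
    unfolding curve_set_eq_image image_Un by (simp only:)
qed

text \<open>For nonsquare \<open>y\<close> the factor \<nu> reverses both signs, which turns the
  stated index condition into membership in \<open>Z\<^sub>B\<close>. The slope 0 is in neither set,
  so the hyperbolas miss nothing.\<close>

lemma base_C_eq:
  "base_C = {0} \<times> {y. quad_char y = eps}
     \<union> hyperbola_set 0 {i \<in> indices. \<omega> powi i \<in> Z\<^sub>A}
     \<union> hyperbola_set 1 {i \<in> indices. \<omega> powi i \<in> {z. \<eta>\<^sub>1 z = 1 \<and> \<eta>\<^sub>2 z \<ge> 0}}"
proof -
  have "hyperbola_set 0 {i \<in> indices. \<omega> powi i \<in> Z\<^sub>A}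
      = {(u, z * u ^ q) | u z. quad_char u = (- 1) ^ 0 \<and> z \<noteq> 0 \<and> \<nu> ^ 0 * z \<in> Z\<^sub>A}"
    by (rule hyperbola_set_eq) (simp add: Z\<^sub>A_def Z_square_mult)
  also have "\<dots> = {(u, z * u ^ q) | u z. quad_char u = 1 \<and> z \<in> Z\<^sub>A}"
  proof -
    have "z \<noteq> 0 \<and> \<nu> ^ 0 * z \<in> Z\<^sub>A \<longleftrightarrow> z \<in> Z\<^sub>A" for z
      by (auto simp: Z\<^sub>A_def)
    then show ?thesis
      by (simp only: power_0)
  qed
  finally have 1: "hyperbola_set 0 {i \<in> indices. \<omega> powi i \<in> Z\<^sub>A} = \<dots>" .
  have "hyperbola_set 1 {i \<in> indices. \<omega> powi i \<in> {z. \<eta>\<^sub>1 z = 1 \<and> \<eta>\<^sub>2 z \<ge> 0}}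
      = {(u, z * u ^ q) | u z. quad_char u = (- 1) ^ 1 \<and> z \<noteq> 0
          \<and> \<nu> ^ 1 * z \<in> {z. \<eta>\<^sub>1 z = 1 \<and> \<eta>\<^sub>2 z \<ge> 0}}"
    by (rule hyperbola_set_eq) (simp add: Z_square_mult)
  also have "\<dots> = {(u, z * u ^ q) | u z. quad_char u = - 1 \<and> z \<in> Z\<^sub>B}"
  proof -
    have "z \<noteq> 0 \<and> \<nu> ^ 1 * z \<in> {z. \<eta>\<^sub>1 z = 1 \<and> \<eta>\<^sub>2 z \<ge> 0} \<longleftrightarrow> z \<in> Z\<^sub>B" for z
      by (auto simp: Z\<^sub>B_def Z_nu_mult)
    then show ?thesis
      by (simp only: power_one_right)
  qed
  finally have 2: "hyperbola_set 1 {i \<in> indices. \<omega> powi i \<in> {z. \<eta>\<^sub>1 z = 1 \<and> \<eta>\<^sub>2 z \<ge> 0}} = \<dots>" .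
  show ?thesis
    unfolding base_C_def curve_set_eq_Un 1 2 by (simp only: Un_assoc)
qed

text \<open>The slope 0 lies in \<open>Z\<^sub>A'\<close> but not on any hyperbola; it supplies the
  axis.\<close>

lemma curve_set'_eq:
  "curve_set Z\<^sub>A' Z\<^sub>B' = {y. quad_char y = 1} \<times> {0}
     \<union> hyperbola_set 0 {i \<in> indices. \<omega> powi i \<in> Z\<^sub>A'}
     \<union> hyperbola_set 1 {i \<in> indices. \<omega> powi i \<in> {z. \<eta>\<^sub>1 z = 1 \<and> \<eta>\<^sub>2 z = - 1}}"
proof -
  have "hyperbola_set 0 {i \<in> indices. \<omega> powi i \<in> Z\<^sub>A'}
      = {(u, z * u ^ q) | u z. quad_char u = (- 1) ^ 0 \<and> z \<noteq> 0 \<and> \<nu> ^ 0 * z \<in> Z\<^sub>A'}"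
    by (rule hyperbola_set_eq) (simp add: Z\<^sub>A'_def Z_square_mult)
  moreover have "0 \<in> Z\<^sub>A'"
    by (simp add: Z\<^sub>A'_def)
  then have "{(u, z * u ^ q) | u z. quad_char u = 1 \<and> z \<in> Z\<^sub>A'} = {y. quad_char y = 1} \<times> {0} \<union>
      {(u, z * u ^ q) | u z. quad_char u = (- 1) ^ 0 \<and> z \<noteq> 0 \<and> \<nu> ^ 0 * z \<in> Z\<^sub>A'}"
    by (auto intro: exI[of _ "0 :: 'a"])
  ultimately have 1: "{(u, z * u ^ q) | u z. quad_char u = 1 \<and> z \<in> Z\<^sub>A'}
      = {y. quad_char y = 1} \<times> {0} \<union> hyperbola_set 0 {i \<in> indices. \<omega> powi i \<in> Z\<^sub>A'}"
    by (simp only:)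
  have "hyperbola_set 1 {i \<in> indices. \<omega> powi i \<in> {z. \<eta>\<^sub>1 z = 1 \<and> \<eta>\<^sub>2 z = - 1}}
      = {(u, z * u ^ q) | u z. quad_char u = (- 1) ^ 1 \<and> z \<noteq> 0
          \<and> \<nu> ^ 1 * z \<in> {z. \<eta>\<^sub>1 z = 1 \<and> \<eta>\<^sub>2 z = - 1}}"
    by (rule hyperbola_set_eq) (simp add: Z_square_mult)
  also have "\<dots> = {(u, z * u ^ q) | u z. quad_char u = - 1 \<and> z \<in> Z\<^sub>B'}"
  proof -
    have "z \<noteq> 0 \<and> \<nu> ^ 1 * z \<in> {z. \<eta>\<^sub>1 z = 1 \<and> \<eta>\<^sub>2 z = - 1} \<longleftrightarrow> z \<in> Z\<^sub>B'" for z
      by (auto simp: Z\<^sub>B'_def Z_nu_mult)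
    then show ?thesis
      by (simp only: power_one_right)
  qed
  finally have 2: "hyperbola_set 1 {i \<in> indices. \<omega> powi i \<in> {z. \<eta>\<^sub>1 z = 1 \<and> \<eta>\<^sub>2 z = - 1}} = \<dots>" .
  show ?thesis
    unfolding curve_set_eq_Un 1 2 by (simp only: Un_assoc)
qed

lemma twist_hyperbola_set:
  "twist ` hyperbola_set k I = {(x * y * \<omega>, x * inverse y * \<omega> powi (i + int q)) | x y i.
     x \<in> Fq - {0} \<and> y \<in> cyc_class \<omega> 2 k \<and> i \<in> I}"
proof -
  have "twist (x * y, x * inverse y * \<omega> powi i) = (x * y * \<omega>, x * inverse y * \<omega> powi (i + int q))" for x y i
    by (simp add: twist_def power_int_add mult_ac)
  moreover have "twist ` hyperbola_set k I = {twist (x * y, x * inverse y * \<omega> powi i) | x y i.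
      x \<in> Fq - {0} \<and> y \<in> cyc_class \<omega> 2 k \<and> i \<in> I}"
    unfolding hyperbola_set_def by blast
  ultimately show ?thesis
    by (simp only:)
qed

lemma twist_axis:
  "twist ` {(0, y) | y. y \<in> cyc_class \<omega> 2 k} = {(0, y) | y. y \<in> cyc_class \<omega> 2 (k + 1)}"
  "twist ` {(y, 0) | y. y \<in> cyc_class \<omega> 2 k} = {(y, 0) | y. y \<in> cyc_class \<omega> 2 (k + 1)}"
proof -
  have *: "quad_char (w * y) = (- 1) ^ (k + 1) \<longleftrightarrow> quad_char y = (- 1) ^ k" if "quad_char w = - 1" for w y :: 'a
    using that by (simp add: quad_char_mult)
  have **: "\<exists>x. quad_char x = (- 1) ^ k \<and> y = w * x"
    if "quad_char w = - 1" "quad_char y = (- 1) ^ (k + 1)" for w y :: 'a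
    using that *[OF that(1), of "y / w"] by (intro exI[of _ "y / w"]) auto
  show "twist ` {(0, y) | y. y \<in> cyc_class \<omega> 2 k} = {(0, y) | y. y \<in> cyc_class \<omega> 2 (k + 1)}"
    unfolding cyc_class_2 using *[of "\<omega> ^ q"] **[of "\<omega> ^ q"]
    by (auto simp: twist_def image_iff quad_char_power_q)
  show "twist ` {(y, 0) | y. y \<in> cyc_class \<omega> 2 k} = {(y, 0) | y. y \<in> cyc_class \<omega> 2 (k + 1)}"
    unfolding cyc_class_2 using *[of \<omega>] **[of \<omega>]
    by (auto simp: twist_def image_iff)
qed

text \<open>Stated with an axis part on both sides; sets without one are covered by an empty
  \<open>Y\<close> or \<open>Y'\<close>.\<close>

lemma axis_curve_set_disjoint:
  assumes "Y \<inter> Y' = {}" "Z1 \<inter> Z3 = {}" "Z2 \<inter> Z4 = {}"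
  shows "({0} \<times> Y \<union> curve_set Z1 Z2) \<inter> ({0} \<times> Y' \<union> curve_set Z3 Z4) = {}"
proof -
  have "({0} \<times> V) \<inter> curve_set V1 V2 = {}" "curve_set V1 V2 \<inter> ({0} \<times> V) = {}" for V V1 V2
    by (auto simp: mem_curve_set)
  moreover have "({0 :: 'a} \<times> Y) \<inter> ({0} \<times> Y') = {}"
    using assms(1) by auto
  ultimately show ?thesis
    unfolding Int_Un_distrib Int_Un_distrib2 curve_set_disjoint[OF assms(2,3)] by simp
qed

text \<open>Surjectivity of the trace pair gives an element with traces 0 and 1. This index is
  needed to recognise \<beta>.\<close>

lemma ex_index_eta:
  obtains i where "i \<in> indices" "\<eta>\<^sub>1 (\<omega> powi i) = 0" "\<eta>\<^sub>2 (\<omega> powi i) = 1"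
proof -
  have "(0, 1) \<in> (\<lambda>z. (T z, T (\<delta> * z))) ` UNIV"
    using bij_betw_trace_pair by (simp add: bij_betw_def)
  then obtain z where "T z = 0" "T (\<delta> * z) = 1"
    by auto
  moreover have "\<eta> 1 = 1"
    using eta_omega_power[of 0] by simp
  ultimately have z: "\<eta>\<^sub>1 z = 0" "\<eta>\<^sub>2 z = 1"
    by (simp_all add: \<eta>\<^sub>1_def \<eta>\<^sub>2_def)
  then have "z \<noteq> 0"
    by auto
  then obtain i r where "i \<in> indices" "r \<in> Fq" "r \<noteq> 0" "z = r ^ 2 * \<omega> powi i"
    by (rule nonzero_eq_powi_mult_square)
  then show ?thesis
    using z that by (simp add: Z_square_mult)
qed

lemma twist_base_C: "twist ` base_C = {0} \<times> {y. quad_char y = - eps} \<union> curve_set Z\<^sub>B Z\<^sub>A"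
proof -
  obtain k where k: "eps = (- 1) ^ k"
    by (simp add: eps_def)
  have 1: "{0} \<times> {y. quad_char y = eps} = {(0, y) | y. y \<in> cyc_class \<omega> 2 k}"
    by (auto simp: cyc_class_2 k)
  have 2: "{0} \<times> {y. quad_char y = - eps} = {(0, y) | y. y \<in> cyc_class \<omega> 2 (k + 1)}"
    by (auto simp: cyc_class_2 k)
  show ?thesis
    unfolding base_C_def image_Un twist_curve_set 1 2 twist_axis ..
qed

text \<open>The two halves of the axis and the origin form \<open>line_inf\<close>, and each slope
  in the union now occurs over all \<open>u\<close>.\<close>

lemma base_C_Un_twist:
  "base_C \<union> twist ` base_C \<union> {(0, 0)} = \<Union> (insert line_inf (line ` (Z\<^sub>A \<union> Z\<^sub>B)))"
proof -
  have "{0} \<times> {y. quad_char y = eps} \<union> {0} \<times> {y. quad_char y = - eps} \<union> {(0, 0)} = line_inf"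
    using eps_cases by (auto simp: line_inf_def dest: quad_char_cases)
  moreover have "{(u, z * u ^ q) | u z. u \<noteq> 0 \<and> z \<in> Z\<^sub>A \<union> Z\<^sub>B} \<union> {(0, 0)} \<union> line_inf
      = \<Union> (insert line_inf (line ` (Z\<^sub>A \<union> Z\<^sub>B)))"
    using q_pos by (auto simp: line_inf_def line_def zero_power)
  ultimately show ?thesis
    unfolding twist_base_C curve_set_Un_swap[symmetric] unfolding base_C_def by blast
qed

lemma curve_set'_Un_swap:
  "curve_set Z\<^sub>A' Z\<^sub>B' \<union> curve_set Z\<^sub>B' Z\<^sub>A' \<union> {(0, 0)} = \<Union> (line ` (Z\<^sub>A' \<union> Z\<^sub>B'))"
proof -
  have "0 \<in> Z\<^sub>A' \<union> Z\<^sub>B'"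
    by (simp add: Z\<^sub>A'_def)
  then show ?thesis
    unfolding curve_set_Un_swap using q_pos by (fastforce simp: line_def zero_power)
qed

text \<open>There are \<open>m = (q ^ 2 - 1) div 2\<close> slopes in
  \<open>Z\<^sub>A \<union> Z\<^sub>B\<close>; with \<open>line_inf\<close> this gives
  \<open>m + 1\<close> components, which take the indices from 0 to \<open>m\<close>.\<close>

lemma ex_spread_enumeration:
  obtains K where "bij_betw K {0..q ^ 2} (spread_family q)"
    "base_C \<union> twist ` base_C \<union> {(0, 0)} = (\<Union>i\<in>{0..(q ^ 2 - 1) div 2}. K i)"
    "curve_set Z\<^sub>A' Z\<^sub>B' \<union> curve_set Z\<^sub>B' Z\<^sub>A' \<union> {(0, 0)} = (\<Union>i\<in>{(q ^ 2 + 1) div 2..q ^ 2}. K i)"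
proof -
  define F where "F = insert line_inf (line ` (Z\<^sub>A \<union> Z\<^sub>B))"
  define G where "G = line ` (Z\<^sub>A' \<union> Z\<^sub>B')"
  define m where "m = (q ^ 2 - 1) div 2"
  have m: "2 * m + 1 = q ^ 2"
    using even_q_square_minus_1 q_square_ge_9 by (simp add: m_def)
  then have "int q ^ 2 = 2 * int m + 1"
    by (metis of_nat_1 of_nat_add of_nat_mult of_nat_numeral of_nat_power)
  then have card: "card (Z\<^sub>A \<union> Z\<^sub>B) = m" "card (Z\<^sub>A' \<union> Z\<^sub>B') = m + 1"
    using card_Z card_Z' by linarith+
  have inj: "inj_on line Z" for Z
    using inj_line by (rule inj_on_subset) simp
  have "card F = m + 1"
    using line_inf_neq by (simp add: F_def card_insert_if card_image[OF inj] card(1) image_iff)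
  moreover have "card G = q ^ 2 - m"
    unfolding G_def card_image[OF inj] card(2) using m by simp
  moreover have "F \<inter> G = {}"
    using line_inf_neq inj_line Z_compl unfolding F_def G_def inj_def by (metis (no_types, lifting)
      Compl_disjoint Int_insert_left_if0 image_Int image_empty imageE inj_line)
  moreover have "F \<union> G = spread_family q"
    unfolding F_def G_def spread_family_eq Z_compl by (metis Compl_partition Un_insert_left image_Un)
  moreover have "m \<le> q ^ 2" "finite F" "finite G"
    using m by simp_all
  ultimately obtain K where K: "bij_betw K {0..q ^ 2} (spread_family q)" "K ` {0..m} = F" "K ` {m + 1..q ^ 2} = G"
    using ex_bij_betw_split[of F G m "q ^ 2"] by metis
  have "m + 1 = (q ^ 2 + 1) div 2"
    using m by simp
  then show ?thesis
    using that[OF K(1)] K(2,3) base_C_Un_twist curve_set'_Un_swap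
    by (simp add: F_def G_def m_def)
qed

end

section \<open>Identification of the index sets by sign patterns, and the properties of the four
  sets\<close>

theorem corollary4p8:
  fixes p n q \<tau> :: nat
    and \<omega> :: "'a::finite_field"
    and \<zeta> :: complex
    and c \<alpha> \<beta> \<gamma> :: int
    and A B A' B' :: "int set"
    and C0 C1 C2 C3 :: "('a \<times> 'a) set"
  assumes "prime p" and "n > 0" and "q = p ^ n" and "odd q"
    and "card (UNIV :: 'a set) = q ^ 2"
    and "primitive_element \<omega>"
    and "primitive_complex_root p \<zeta>"
    and "c \<in> {0..2 * int q + 1}" and "odd c"
    and "X1 \<omega> q c = {\<alpha>, \<beta>}"
    and "X1 \<omega> q ((c + int q + 1) mod (2 * (int q + 1))) = {\<alpha>, \<gamma>}"
    and "X1 \<omega> q c \<inter> X1 \<omega> q ((c + int q + 1) mod (2 * (int q + 1))) = {\<alpha>}"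
    and "A = {\<beta>} \<union> X3 \<omega> q c"
    and "B = {\<alpha>} \<union> X3 \<omega> q c"
    and "A' = X1 \<omega> q ((c + int q + 1) mod (2 * (int q + 1)))
            \<union> X3 \<omega> q ((c + int q + 1) mod (2 * (int q + 1)))"
    and "B' = X3 \<omega> q ((c + int q + 1) mod (2 * (int q + 1)))"
    and "\<tau> = (if q mod 4 = 3 then 0 else 1)"
    and "C0 = {(0, y) | y. y \<in> cyc_class \<omega> 2 \<tau>}
      \<union> {(x * y, x * inverse y * \<omega> powi i) | x y i.
           x \<in> subfield_q q - {0} \<and> y \<in> cyc_class \<omega> 2 0 \<and> i \<in> A}
      \<union> {(x * y, x * inverse y * \<omega> powi i) | x y i.
           x \<in> subfield_q q - {0} \<and> y \<in> cyc_class \<omega> 2 1 \<and> i \<in> B}"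
    and "C1 = {(y, 0) | y. y \<in> cyc_class \<omega> 2 0}
      \<union> {(x * y, x * inverse y * \<omega> powi i) | x y i.
           x \<in> subfield_q q - {0} \<and> y \<in> cyc_class \<omega> 2 0 \<and> i \<in> A'}
      \<union> {(x * y, x * inverse y * \<omega> powi i) | x y i.
           x \<in> subfield_q q - {0} \<and> y \<in> cyc_class \<omega> 2 1 \<and> i \<in> B'}"
    and "C2 = {(0, y) | y. y \<in> cyc_class \<omega> 2 (\<tau> + 1)}
      \<union> {(x * y * \<omega>, x * inverse y * \<omega> powi (i + int q)) | x y i.
           x \<in> subfield_q q - {0} \<and> y \<in> cyc_class \<omega> 2 0 \<and> i \<in> A}
      \<union> {(x * y * \<omega>, x * inverse y * \<omega> powi (i + int q)) | x y i.
           x \<in> subfield_q q - {0} \<and> y \<in> cyc_class \<omega> 2 1 \<and> i \<in> B}"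
    and "C3 = {(y, 0) | y. y \<in> cyc_class \<omega> 2 1}
      \<union> {(x * y * \<omega>, x * inverse y * \<omega> powi (i + int q)) | x y i.
           x \<in> subfield_q q - {0} \<and> y \<in> cyc_class \<omega> 2 0 \<and> i \<in> A'}
      \<union> {(x * y * \<omega>, x * inverse y * \<omega> powi (i + int q)) | x y i.
           x \<in> subfield_q q - {0} \<and> y \<in> cyc_class \<omega> 2 1 \<and> i \<in> B'}"
  shows "type_Q \<zeta> p n C0 \<and> type_Q \<zeta> p n C1 \<and> type_Q \<zeta> p n C2 \<and> type_Q \<zeta> p n C3
    \<and> C0 \<union> C1 \<union> C2 \<union> C3 \<subseteq> UNIV - {(0, 0)}
    \<and> C0 \<inter> C1 = {} \<and> C0 \<inter> C2 = {} \<and> C0 \<inter> C3 = {}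
    \<and> C1 \<inter> C2 = {} \<and> C1 \<inter> C3 = {} \<and> C2 \<inter> C3 = {}
    \<and> is_spread q (spread_family q :: ('a \<times> 'a) set set)
    \<and> (\<exists>K :: nat \<Rightarrow> ('a \<times> 'a) set.
          bij_betw K {0..q ^ 2} (spread_family q)
        \<and> C0 \<union> C2 \<union> {(0, 0)} = (\<Union>i \<in> {0..(q ^ 2 - 1) div 2}. K i)
        \<and> C1 \<union> C3 \<union> {(0, 0)} = (\<Union>i \<in> {(q ^ 2 + 1) div 2..q ^ 2}. K i))"
proof -
  interpret quadratic_extension_char p n q \<omega> \<zeta>
    using assms by unfold_locales
  interpret trace_pair p n q \<omega> \<zeta> "\<omega> powi c"
  proof
    \<comment> \<open>Oddness of \<open>c\<close> is what makes \<open>\<omega> powi c\<close> a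
      nonsquare.\<close>
    obtain k where "c = int k" "odd k"
      using assms(8,9) by (metis atLeastAtMost_iff even_of_nat nonneg_int_cases)
    then show "quad_char (\<omega> powi c) = - 1"
      by (simp add: quad_char_omega_power)
  qed
  define c' where "c' = (c + int q + 1) mod (2 * (int q + 1))"
  have c': "c' = (c + int q + 1) mod M"
    by (simp add: c'_def M_def)
  have X: "X1 \<omega> q c = {j \<in> indices. \<eta>\<^sub>1 (\<omega> powi j) = 0 \<and> \<eta>\<^sub>2 (\<omega> powi j) = 1
        \<or> \<eta>\<^sub>1 (\<omega> powi j) = 1 \<and> \<eta>\<^sub>2 (\<omega> powi j) = 0}"
    "X3 \<omega> q c = {j \<in> indices. \<eta>\<^sub>1 (\<omega> powi j) = 1 \<and> \<eta>\<^sub>2 (\<omega> powi j) = 1}"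
    "X1 \<omega> q c' = {j \<in> indices. \<eta>\<^sub>1 (\<omega> powi j) = 0 \<and> \<eta>\<^sub>2 (\<omega> powi j) = - 1
        \<or> \<eta>\<^sub>1 (\<omega> powi j) = 1 \<and> \<eta>\<^sub>2 (\<omega> powi j) = 0}"
    "X3 \<omega> q c' = {j \<in> indices. \<eta>\<^sub>1 (\<omega> powi j) = 1 \<and> \<eta>\<^sub>2 (\<omega> powi j) = - 1}"
    unfolding X1_eq X3_eq c' eta_T_powi_antipode \<eta>\<^sub>1_def \<eta>\<^sub>2_def by auto
  \<comment> \<open>The patterns with first sign 0 drop out of the intersection, as the second sign
    cannot be both 1 and -1.\<close>
  have "{j \<in> indices. \<eta>\<^sub>1 (\<omega> powi j) = 1 \<and> \<eta>\<^sub>2 (\<omega> powi j) = 0} = X1 \<omega> q c \<inter> X1 \<omega> q c'"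
    unfolding X by auto
  also have "\<dots> = {\<alpha>}"
    using assms(12) by (simp only: c'_def)
  finally have \<alpha>: "{j \<in> indices. \<eta>\<^sub>1 (\<omega> powi j) = 1 \<and> \<eta>\<^sub>2 (\<omega> powi j) = 0} = {\<alpha>}" .
  \<comment> \<open>The pattern (0, 1) occurs, lies within {\<alpha>, \<beta>} and excludes
    \<alpha>, whose first sign is 1.\<close>
  have \<beta>: "{j \<in> indices. \<eta>\<^sub>1 (\<omega> powi j) = 0 \<and> \<eta>\<^sub>2 (\<omega> powi j) = 1} = {\<beta>}"
  proof -
    obtain i where i: "i \<in> indices" "\<eta>\<^sub>1 (\<omega> powi i) = 0" "\<eta>\<^sub>2 (\<omega> powi i) = 1"
      by (rule ex_index_eta)
    have "\<eta>\<^sub>1 (\<omega> powi \<alpha>) = 1"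
      using \<alpha> by auto
    then have "{j \<in> indices. \<eta>\<^sub>1 (\<omega> powi j) = 0 \<and> \<eta>\<^sub>2 (\<omega> powi j) = 1} \<subseteq> {\<alpha>, \<beta>} - {\<alpha>}"
      unfolding assms(10)[symmetric] X by auto
    then show ?thesis
      using i by auto
  qed
  have A: "A = {i \<in> indices. \<omega> powi i \<in> Z\<^sub>A}"
  proof -
    have "\<eta>\<^sub>1 z \<ge> 0 \<longleftrightarrow> \<eta>\<^sub>1 z = 0 \<or> \<eta>\<^sub>1 z = 1" for z
      by (rule eta_values[of "T z"]) (auto simp: \<eta>\<^sub>1_def)
    then show ?thesis
      unfolding assms(13) \<beta>[symmetric] X Z\<^sub>A_def by auto
  qed
  have B: "B = {i \<in> indices. \<omega> powi i \<in> {z. \<eta>\<^sub>1 z = 1 \<and> \<eta>\<^sub>2 z \<ge> 0}}"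
  proof -
    have "\<eta>\<^sub>2 z \<ge> 0 \<longleftrightarrow> \<eta>\<^sub>2 z = 0 \<or> \<eta>\<^sub>2 z = 1" for z
      by (rule eta_values[of "T (\<omega> powi c * z)"]) (auto simp: \<eta>\<^sub>2_def)
    then show ?thesis
      unfolding assms(14) \<alpha>[symmetric] X by auto
  qed
  have A': "A' = {i \<in> indices. \<omega> powi i \<in> Z\<^sub>A'}"
  proof -
    \<comment> \<open>The pattern (0, 0) belongs to 0 alone and so never arises from a power of
      \<omega>.\<close>
    have "z \<in> Z\<^sub>A' \<longleftrightarrow> \<eta>\<^sub>1 z = 0 \<and> \<eta>\<^sub>2 z = - 1 \<or> \<eta>\<^sub>1 z = 1 \<and> \<eta>\<^sub>2 z = 0 \<or> \<eta>\<^sub>1 z = 1 \<and> \<eta>\<^sub>2 z = - 1"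
      if "z \<noteq> 0" for z
      using Z_eq_0D[of z] that
      by (rule_tac eta_values[of "T z"]; rule_tac eta_values[of "T (\<omega> powi c * z)"])
         (auto simp: Z\<^sub>A'_def \<eta>\<^sub>1_def \<eta>\<^sub>2_def)
    then have "\<omega> powi i \<in> Z\<^sub>A' \<longleftrightarrow> \<eta>\<^sub>1 (\<omega> powi i) = 0 \<and> \<eta>\<^sub>2 (\<omega> powi i) = - 1
        \<or> \<eta>\<^sub>1 (\<omega> powi i) = 1 \<and> \<eta>\<^sub>2 (\<omega> powi i) = 0 \<or> \<eta>\<^sub>1 (\<omega> powi i) = 1 \<and> \<eta>\<^sub>2 (\<omega> powi i) = - 1" for i
      by simp
    then show ?thesis
      unfolding assms(15) c'_def[symmetric] X by blast
  qed
  have B': "B' = {i \<in> indices. \<omega> powi i \<in> {z. \<eta>\<^sub>1 z = 1 \<and> \<eta>\<^sub>2 z = - 1}}"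
    unfolding assms(16) c'_def[symmetric] X by simp
  have \<tau>: "(- 1) ^ \<tau> = eps"
  proof -
    have "even ((q + 1) div 2) \<longleftrightarrow> q mod 4 = 3"
      using odd_q by presburger
    then show ?thesis
      by (simp add: assms(17) eps_def)
  qed
  have C0': "C0 = {(0, y) | y. y \<in> cyc_class \<omega> 2 \<tau>} \<union> hyperbola_set 0 A \<union> hyperbola_set 1 B"
    unfolding assms(18) hyperbola_set_def ..
  have C1': "C1 = {(y, 0) | y. y \<in> cyc_class \<omega> 2 0} \<union> hyperbola_set 0 A' \<union> hyperbola_set 1 B'"
    unfolding assms(19) hyperbola_set_def ..
  have "{(0, y) | y. y \<in> cyc_class \<omega> 2 \<tau>} = {0} \<times> {y. quad_char y = eps}"
    by (auto simp: cyc_class_2 \<tau>)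
  then have C0: "C0 = base_C"
    unfolding C0' base_C_eq A B by (intro arg_cong2[of _ _ _ _ "(\<union>)"] refl)
  have "{(y, 0) | y. y \<in> cyc_class \<omega> 2 0} = {y. quad_char y = 1} \<times> {0}"
    by (auto simp: cyc_class_2)
  then have C1: "C1 = curve_set Z\<^sub>A' Z\<^sub>B'"
    unfolding C1' curve_set'_eq A' B' by (intro arg_cong2[of _ _ _ _ "(\<union>)"] refl)
  have C2: "C2 = twist ` base_C"
    unfolding C0[symmetric] C0' image_Un twist_axis twist_hyperbola_set assms(20) ..
  have C3: "C3 = curve_set Z\<^sub>B' Z\<^sub>A'"
    unfolding twist_curve_set[of "Z\<^sub>A'", symmetric] C1[symmetric] C1' image_Un twist_axis twist_hyperbola_set assms(21)
    by simp
  have Q: "type_Q \<zeta> p n C0" "type_Q \<zeta> p n C1" "type_Q \<zeta> p n C2" "type_Q \<zeta> p n C3"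
    unfolding C0 C1 C2 C3 twist_curve_set[of "Z\<^sub>A'", symmetric]
    by (intro type_Q_twist type_Q_base_C type_Q_curve_set')+
  have "E \<subseteq> UNIV - {(0, 0)}" if "type_Q \<zeta> p n E" for E :: "('a \<times> 'a) set"
    using that unfolding type_Q_def by (rule conjunct1)
  then have sub: "C0 \<union> C1 \<union> C2 \<union> C3 \<subseteq> UNIV - {(0, 0)}"
    using Q by (intro Un_least)
  have Z: "Z\<^sub>A \<inter> Z\<^sub>A' = {}" "Z\<^sub>A \<inter> Z\<^sub>B' = {}" "Z\<^sub>B \<inter> Z\<^sub>A' = {}" "Z\<^sub>B \<inter> Z\<^sub>B' = {}"
    "Z\<^sub>A' \<inter> Z\<^sub>A = {}" "Z\<^sub>B' \<inter> Z\<^sub>A = {}" "Z\<^sub>A' \<inter> Z\<^sub>B = {}" "Z\<^sub>B' \<inter> Z\<^sub>B = {}"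
    "Z\<^sub>A \<inter> Z\<^sub>B = {}" "Z\<^sub>B \<inter> Z\<^sub>A = {}" "Z\<^sub>A' \<inter> Z\<^sub>B' = {}" "Z\<^sub>B' \<inter> Z\<^sub>A' = {}"
    using Z_compl Z_disjoint by blast+
  have axis: "{y :: 'a. quad_char y = eps} \<inter> {y. quad_char y = - eps} = {}"
    using eps_cases by auto
  \<comment> \<open>An empty axis part brings these sets into the form required for the disjointness
    argument.\<close>
  have C13: "C1 = {0} \<times> {} \<union> curve_set Z\<^sub>A' Z\<^sub>B'" "C3 = {0} \<times> {} \<union> curve_set Z\<^sub>B' Z\<^sub>A'"
    using C1 C3 by simp_all
  have disjoint: "C0 \<inter> C1 = {}" "C0 \<inter> C2 = {}" "C0 \<inter> C3 = {}" "C1 \<inter> C2 = {}" "C1 \<inter> C3 = {}" "C2 \<inter> C3 = {}"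
    unfolding C0 C2 C13 twist_base_C unfolding base_C_def
    by (rule axis_curve_set_disjoint; simp only: Z axis Int_empty_left Int_empty_right)+
  obtain K where K: "bij_betw K {0..q ^ 2} (spread_family q)"
    "base_C \<union> twist ` base_C \<union> {(0, 0)} = (\<Union>i\<in>{0..(q ^ 2 - 1) div 2}. K i)"
    "curve_set Z\<^sub>A' Z\<^sub>B' \<union> curve_set Z\<^sub>B' Z\<^sub>A' \<union> {(0, 0)} = (\<Union>i\<in>{(q ^ 2 + 1) div 2..q ^ 2}. K i)"
    by (rule ex_spread_enumeration)
  have "\<exists>K. bij_betw K {0..q ^ 2} (spread_family q)
      \<and> C0 \<union> C2 \<union> {(0, 0)} = (\<Union>i\<in>{0..(q ^ 2 - 1) div 2}. K i)
      \<and> C1 \<union> C3 \<union> {(0, 0)} = (\<Union>i\<in>{(q ^ 2 + 1) div 2..q ^ 2}. K i)"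
    unfolding C0 C1 C2 C3 using K by (intro exI[of _ K] conjI)
  with Q sub disjoint is_spread_spread_family show ?thesis
    by (intro conjI)
qed

end
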